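(* Let $k$ be an algebraically closed field, let $S$ be a finite semigroup without identity, and let $V$ be a nonzero finite-dimensional $kS$-module on which no element of $S$ acts invertibly. Let $l(n)$ be the composition length of $V^{\otimes n}$. Then, as $n\to\infty$, $$l(n)\sim(\dim V)^n.$$ Moreover, if $n_0$ denotes the smallest natural number such that the null module $Z$ is a composition factor of $V^{\otimes n_0}$, then $n_0\le L$, where $L$ is the number of $\mathcal L$-classes of $S$.
   Context: $kS$-modules are (non-unital) left modules over the semigroup algebra $kS$, i.e. finite-dimensional $k$-vector spaces with a semigroup homomorphism $S\to\mathrm{End}_k(V)$. The null module $Z$ is the one-dimensional module on which all elements of $S$ act as $0$; it counts as a simple module (so composition length is the length of a maximal chain of $S$-stable subspaces). $V^{\otimes n}$ carries the diagonal action of $S$. Two elements $x,y\in S$ are $\mathcal L$-equivalent if $S^1x=S^1y$, where $S^1$ is $S$ with an identity adjoined. $f\sim g$ means $f(n)/g(n)\to1$. *)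

theory Defs
  imports
    "HOL-Library.Poly_Mapping"
    "HOL-Library.Landau_Symbols"
    "HOL-Computational_Algebra.Polynomial"
begin

text \<open>
  The data of a \<open>kS\<close>-module with an explicit carrier, so that submodules and quotients live on
  sets rather than on types. The semigroup is the whole type \<open>'s\<close>. The record does not carry
  the module axioms; they hold for every module formed in this theory from a representation.
\<close>

record ('k, 's, 'm) ks_module =
  carr :: "'m set"
  mzero :: 'm
  madd :: "'m \<Rightarrow> 'm \<Rightarrow> 'm"
  msmul :: "'k \<Rightarrow> 'm \<Rightarrow> 'm"
  mact :: "'s \<Rightarrow> 'm \<Rightarrow> 'm"

definition ks_submodule :: "('k, 's, 'm) ks_module \<Rightarrow> 'm set \<Rightarrow> bool" where
  "ks_submodule M N \<longleftrightarrow>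
     N \<subseteq> carr M \<and> mzero M \<in> N \<and>
     (\<forall>x\<in>N. \<forall>y\<in>N. madd M x y \<in> N) \<and>
     (\<forall>c. \<forall>x\<in>N. msmul M c x \<in> N) \<and>
     (\<forall>s. \<forall>x\<in>N. mact M s x \<in> N)"

text \<open>
  The elements of the quotient are the cosets \<open>a + N\<close>. The summand from \<open>N\<close> in the
  scalar multiplication and in the action makes the results full cosets (e.g. for the scalar 0).
\<close>

definition ks_quotient :: "('k, 's, 'm) ks_module \<Rightarrow> 'm set \<Rightarrow> ('k, 's, 'm set) ks_module" where
  "ks_quotient M N =
     \<lparr> carr = {madd M a ` N | a. a \<in> carr M},
       mzero = N,
       madd = (\<lambda>A B. {madd M a b | a b. a \<in> A \<and> b \<in> B}),
       msmul = (\<lambda>c A. {madd M (msmul M c a) x | a x. a \<in> A \<and> x \<in> N}),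
       mact = (\<lambda>s A. {madd M (mact M s a) x | a x. a \<in> A \<and> x \<in> N}) \<rparr>"

definition ks_factor :: "('k, 's, 'm) ks_module \<Rightarrow> 'm set \<Rightarrow> 'm set \<Rightarrow> ('k, 's, 'm set) ks_module" where
  "ks_factor M Y X = ks_quotient (M\<lparr>carr := Y\<rparr>) X"

definition ks_isomorphic :: "('k, 's, 'm) ks_module \<Rightarrow> ('k, 's, 'n) ks_module \<Rightarrow> bool" where
  "ks_isomorphic M N \<longleftrightarrow>
     (\<exists>f. bij_betw f (carr M) (carr N) \<and>
        (\<forall>x\<in>carr M. \<forall>y\<in>carr M. f (madd M x y) = madd N (f x) (f y)) \<and>
        (\<forall>c. \<forall>x\<in>carr M. f (msmul M c x) = msmul N c (f x)) \<and>
        (\<forall>s. \<forall>x\<in>carr M. f (mact M s x) = mact N s (f x)))"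

text \<open>
  There is no condition that the action be nonzero: the null module is simple.
\<close>

definition ks_simple :: "('k, 's, 'm) ks_module \<Rightarrow> bool" where
  "ks_simple M \<longleftrightarrow>
     carr M \<noteq> {mzero M} \<and> (\<forall>N. ks_submodule M N \<longrightarrow> N = {mzero M} \<or> N = carr M)"

definition null_module :: "('k::field, 's, 'k) ks_module" where
  "null_module =
     \<lparr> carr = UNIV, mzero = 0, madd = (+), msmul = (*), mact = (\<lambda>_ _. 0) \<rparr>"

definition composition_series :: "('k, 's, 'm) ks_module \<Rightarrow> 'm set list \<Rightarrow> bool" where
  "composition_series M Ns \<longleftrightarrow>
     Ns \<noteq> [] \<and> hd Ns = {mzero M} \<and> last Ns = carr M \<and>
     (\<forall>N\<in>set Ns. ks_submodule M N) \<and>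
     (\<forall>i. Suc i < length Ns \<longrightarrow>
        Ns ! i \<subseteq> Ns ! Suc i \<and> ks_simple (ks_factor M (Ns ! Suc i) (Ns ! i)))"

text \<open>
  The value does not depend on the choice, by the Jordan--Hoelder theorem. A list of \<open>l + 1\<close>
  submodules is a series of length \<open>l\<close>.
\<close>

definition composition_length :: "('k, 's, 'm) ks_module \<Rightarrow> nat" where
  "composition_length M = (SOME l. \<exists>Ns. composition_series M Ns \<and> length Ns = Suc l)"

definition composition_factor :: "('k, 's, 'n) ks_module \<Rightarrow> ('k, 's, 'm) ks_module \<Rightarrow> bool" where
  "composition_factor Z M \<longleftrightarrow>
     (\<exists>Ns i. composition_series M Ns \<and> Suc i < length Ns \<and>
        ks_isomorphic (ks_factor M (Ns ! Suc i) (Ns ! i)) Z)"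

text \<open>
  A (non-unital) \<open>kS\<close>-module structure on the \<open>k\<close>-vector space given by a whole type with
  scalar multiplication \<open>scale\<close>.
\<close>

locale ks_representation = vector_space scale
  for scale :: "'k::field \<Rightarrow> 'v::ab_group_add \<Rightarrow> 'v" +
  fixes \<rho> :: "'s::semigroup_mult \<Rightarrow> 'v \<Rightarrow> 'v"
  assumes linear_rep: "Vector_Spaces.linear scale scale (\<rho> s)"
    and rep_mult: "\<rho> (s * t) = \<rho> s \<circ> \<rho> t"

text \<open>
  The tensor power \<open>V\<^sup>\<otimes>\<^sup>n\<close> is the free vector space on the \<open>n\<close>-tuples of vectors modulo the
  multilinearity relations, where \<open>Poly_Mapping.single [v\<^sub>1, \<dots>, v\<^sub>n] 1\<close> represents the pure
  tensor of \<open>v\<^sub>1, \<dots>, v\<^sub>n\<close> and \<open>s\<close> acts by applying \<open>\<rho> s\<close> to each entry.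
  For \<open>n = 0\<close> this is the one-dimensional module on which every \<open>s\<close> acts as the identity.
\<close>

definition free_smul :: "'k::field \<Rightarrow> ('b \<Rightarrow>\<^sub>0 'k) \<Rightarrow> ('b \<Rightarrow>\<^sub>0 'k)" where
  "free_smul c = Poly_Mapping.map ((*) c)"

definition free_tensor_module ::
    "('s \<Rightarrow> 'v \<Rightarrow> 'v) \<Rightarrow> nat \<Rightarrow> ('k::field, 's, 'v list \<Rightarrow>\<^sub>0 'k) ks_module" where
  "free_tensor_module \<rho> n =
     \<lparr> carr = {f. \<forall>vs\<in>Poly_Mapping.keys f. length vs = n},
       mzero = 0,
       madd = (+),
       msmul = free_smul,
       mact = (\<lambda>s f. \<Sum>vs\<in>Poly_Mapping.keys f.
                 Poly_Mapping.single (map (\<rho> s) vs) (Poly_Mapping.lookup f vs)) \<rparr>"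

definition multilinear_relators ::
    "('k::field \<Rightarrow> 'v::ab_group_add \<Rightarrow> 'v) \<Rightarrow> nat \<Rightarrow> ('v list \<Rightarrow>\<^sub>0 'k) set" where
  "multilinear_relators scale n =
     {Poly_Mapping.single (xs @ (u + v) # ys) 1
        - Poly_Mapping.single (xs @ u # ys) 1 - Poly_Mapping.single (xs @ v # ys) 1
      | xs ys u v. length xs + 1 + length ys = n} \<union>
     {Poly_Mapping.single (xs @ scale c u # ys) 1
        - free_smul c (Poly_Mapping.single (xs @ u # ys) 1)
      | xs ys c u. length xs + 1 + length ys = n}"

definition tensor_power ::
    "('k::field \<Rightarrow> 'v::ab_group_add \<Rightarrow> 'v) \<Rightarrow> ('s \<Rightarrow> 'v \<Rightarrow> 'v) \<Rightarrow> nat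
      \<Rightarrow> ('k, 's, ('v list \<Rightarrow>\<^sub>0 'k) set) ks_module" where
  "tensor_power scale \<rho> n =
     ks_quotient (free_tensor_module \<rho> n) (module.span free_smul (multilinear_relators scale n))"

definition left_ideal1 :: "'s::semigroup_mult \<Rightarrow> 's set" where
  "left_ideal1 x = insert x (range (\<lambda>s. s * x))"

definition L_equiv :: "('s::semigroup_mult \<times> 's) set" where
  "L_equiv = {(x, y). left_ideal1 x = left_ideal1 y}"

end

theory Submission
  imports Defs
begin

text \<open>
  Let \<open>d = dim V\<close>. Elements of one \<open>\<L>\<close>-class have a common kernel on \<open>V\<close>, so noninvertibility
  gives nonzero vectors \<open>v\<^sub>0, \<dots>, v\<^bsub>L-1\<^esub>\<close> such that every element of \<open>S\<close> kills one of them, and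
  the whole of \<open>S\<close> annihilates a pure tensor in which all of them occur. In particular
  \<open>v\<^sub>0 \<otimes> \<dots> \<otimes> v\<^bsub>L-1\<^esub>\<close> spans a copy of the null module in the \<open>L\<close>-th tensor power.

  Choose a basis of \<open>V\<close> for each tensor position, containing \<open>v\<^sub>i\<close> at the positions congruent to
  \<open>i\<close> modulo \<open>L\<close>. Then all but at most \<open>L (1 - 1/d)\<^bsup>n div L\<^esup> d\<^sup>n\<close> of the \<open>d\<^sup>n\<close> product basis
  vectors are annihilated. The composition length is at most \<open>d\<^sup>n\<close> and at least the dimension of
  the annihilated part.
\<close>

subsection \<open>Composition series of finite-dimensional modules\<close>

text \<open>
  A module whose carrier is identified by \<open>h\<close> with a subspace of a vector space on a whole type,
  so that the library's linear algebra applies to it.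
\<close>

locale embedded_ks_module = vector_space scale
  for scale :: "'k::field \<Rightarrow> 'w::ab_group_add \<Rightarrow> 'w" +
  fixes M :: "('k, 's, 'm) ks_module" and h :: "'m \<Rightarrow> 'w"
  assumes inj_h: "inj_on h (carr M)"
    and zero_carr [simp]: "mzero M \<in> carr M"
    and add_carr [simp]: "\<lbrakk>x \<in> carr M; y \<in> carr M\<rbrakk> \<Longrightarrow> madd M x y \<in> carr M"
    and smul_carr [simp]: "x \<in> carr M \<Longrightarrow> msmul M c x \<in> carr M"
    and act_carr [simp]: "x \<in> carr M \<Longrightarrow> mact M s x \<in> carr M"
    and h_zero [simp]: "h (mzero M) = 0"
    and h_add [simp]: "\<lbrakk>x \<in> carr M; y \<in> carr M\<rbrakk> \<Longrightarrow> h (madd M x y) = h x + h y"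
    and h_smul [simp]: "x \<in> carr M \<Longrightarrow> h (msmul M c x) = scale c (h x)"
    and act_add: "\<lbrakk>x \<in> carr M; y \<in> carr M\<rbrakk> \<Longrightarrow>
      mact M s (madd M x y) = madd M (mact M s x) (mact M s y)"
    and act_smul: "x \<in> carr M \<Longrightarrow> mact M s (msmul M c x) = msmul M c (mact M s x)"
begin

lemma eq_iff_h: "\<lbrakk>x \<in> carr M; y \<in> carr M\<rbrakk> \<Longrightarrow> x = y \<longleftrightarrow> h x = h y"
  using inj_h by (auto dest: inj_onD)

lemma smul_0: "x \<in> carr M \<Longrightarrow> msmul M 0 x = mzero M"
  by (simp add: eq_iff_h)

lemma smul_zero: "msmul M c (mzero M) = mzero M"
  by (simp add: eq_iff_h)

lemma add_zero: "x \<in> carr M \<Longrightarrow> madd M x (mzero M) = x"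
  by (simp add: eq_iff_h)

lemma act_zero: "mact M s (mzero M) = mzero M"
  using act_smul[of "mzero M" s 0] by (simp add: smul_0)

lemma h_in_image_iff: "\<lbrakk>x \<in> carr M; N \<subseteq> carr M\<rbrakk> \<Longrightarrow> h x \<in> h ` N \<longleftrightarrow> x \<in> N"
  using inj_h by (meson inj_on_image_mem_iff)

lemma submodule_carr: "ks_submodule M (carr M)"
  by (simp add: ks_submodule_def)

lemma submodule_zero: "ks_submodule M {mzero M}"
  by (auto simp: ks_submodule_def add_zero smul_zero act_zero)

lemma subspace_image_submodule: "ks_submodule M N \<Longrightarrow> subspace (h ` N)"
  unfolding subspace_def ks_submodule_def
  by (smt (verit) h_add h_smul h_zero image_iff subset_eq)

lemma embedded_submodule:
  assumes "ks_submodule M Y"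
  shows "embedded_ks_module scale (M\<lparr>carr := Y\<rparr>) h"
proof -
  have Y: "Y \<subseteq> carr M" using assms by (simp add: ks_submodule_def)
  show ?thesis
    by unfold_locales
      (use assms inj_on_subset[OF inj_h Y] in
        \<open>auto simp: ks_submodule_def act_add act_smul subset_eq\<close>)
qed

section \<open>Cosets and quotient modules\<close>

definition coset :: "'m set \<Rightarrow> 'm \<Rightarrow> 'm set" where
  "coset N a = madd M a ` N"

text \<open>The module record has no subtraction. Passing to images under \<open>h\<close> turns
  coset membership into a condition on differences, where closure properties of subspaces can be
  used.\<close>

lemma mem_coset_iff:
  assumes "ks_submodule M N" "a \<in> carr M"
  shows "b \<in> coset N a \<longleftrightarrow> b \<in> carr M \<and> h b - h a \<in> h ` N"
proof
  assume "b \<in> coset N a"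
  then show "b \<in> carr M \<and> h b - h a \<in> h ` N"
    using assms by (auto simp: coset_def ks_submodule_def)
next
  assume b: "b \<in> carr M \<and> h b - h a \<in> h ` N"
  then obtain x where x: "x \<in> N" "h b - h a = h x" by auto
  then have "x \<in> carr M" using assms by (auto simp: ks_submodule_def)
  with x b assms have "b = madd M a x"
    by (subst eq_iff_h) (auto simp: algebra_simps)
  then show "b \<in> coset N a" using x by (auto simp: coset_def)
qed

lemma coset_subset_carr: "\<lbrakk>ks_submodule M N; a \<in> carr M\<rbrakk> \<Longrightarrow> coset N a \<subseteq> carr M"
  using mem_coset_iff by blast

lemma self_mem_coset: "\<lbrakk>ks_submodule M N; a \<in> carr M\<rbrakk> \<Longrightarrow> a \<in> coset N a"
  using subspace_0[OF subspace_image_submodule] by (simp add: mem_coset_iff)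

lemma coset_eq_iff:
  assumes "ks_submodule M N" "a \<in> carr M" "b \<in> carr M"
  shows "coset N a = coset N b \<longleftrightarrow> h a - h b \<in> h ` N"
proof
  assume "coset N a = coset N b"
  then have "a \<in> coset N b" using self_mem_coset assms by blast
  then show "h a - h b \<in> h ` N" using assms by (simp add: mem_coset_iff)
next
  assume ab: "h a - h b \<in> h ` N"
  note sub = subspace_image_submodule[OF assms(1)]
  have "h c - h a \<in> h ` N \<longleftrightarrow> h c - h b \<in> h ` N" for c
    using subspace_add[OF sub _ ab, of "h c - h a"] subspace_diff[OF sub _ ab, of "h c - h b"]
    by (auto simp: algebra_simps)
  then show "coset N a = coset N b" using assms by (auto simp: mem_coset_iff)
qed

lemma coset_mzero:
  assumes "ks_submodule M N"
  shows "coset N (mzero M) = N"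
proof -
  have "N \<subseteq> carr M" using assms by (simp add: ks_submodule_def)
  then have "madd M (mzero M) ` N = (\<lambda>x. x) ` N"
    by (intro image_cong refl) (auto simp: eq_iff_h)
  then show ?thesis by (simp add: coset_def)
qed

lemma coset_eq_self_iff:
  assumes "ks_submodule M N" "a \<in> carr M"
  shows "coset N a = N \<longleftrightarrow> a \<in> N"
  using coset_eq_iff[OF assms zero_carr] assms h_in_image_iff
  by (simp add: coset_mzero ks_submodule_def)

lemma quotient_carr: "carr (ks_quotient M N) = coset N ` carr M"
  by (auto simp: ks_quotient_def coset_def)

lemma quotient_mzero: "mzero (ks_quotient M N) = N"
  by (simp add: ks_quotient_def)

lemma quotient_add:
  assumes N: "ks_submodule M N" and a: "a \<in> carr M" and b: "b \<in> carr M"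
  shows "madd (ks_quotient M N) (coset N a) (coset N b) = coset N (madd M a b)"
proof -
  note sub = subspace_image_submodule[OF N]
  have "madd M x y \<in> coset N (madd M a b)" if "x \<in> coset N a" "y \<in> coset N b" for x y
    using that a b subspace_add[OF sub, of "h x - h a" "h y - h b"]
    by (simp add: mem_coset_iff[OF N] algebra_simps)
  moreover have "\<exists>x y. z = madd M x y \<and> x \<in> coset N a \<and> y \<in> coset N b"
    if z: "z \<in> coset N (madd M a b)" for z
  proof -
    \<comment> \<open>The witness is \<open>z\<close> minus \<open>b\<close>, with the difference
      formed by the scalar -1.\<close>
    define x where "x = madd M z (msmul M (-1) b)"
    have zc: "z \<in> carr M" using z coset_subset_carr N a b add_carr by blast
    have "z = madd M x b" using zc b by (simp add: eq_iff_h x_def)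
    moreover have "x \<in> coset N a" using z a b zc
      by (simp add: mem_coset_iff[OF N] x_def algebra_simps)
    ultimately show ?thesis using self_mem_coset[OF N b] by blast
  qed
  ultimately show ?thesis by (auto simp: ks_quotient_def)
qed

lemma quotient_smul:
  assumes N: "ks_submodule M N" and a: "a \<in> carr M"
  shows "msmul (ks_quotient M N) c (coset N a) = coset N (msmul M c a)"
proof -
  note sub = subspace_image_submodule[OF N]
  have "madd M (msmul M c x) y \<in> coset N (msmul M c a)" if x: "x \<in> coset N a" and y: "y \<in> N" for x y
  proof -
    have "y \<in> carr M" using y N by (auto simp: ks_submodule_def)
    then show ?thesis
      using x y a subspace_add[OF sub subspace_scale[OF sub, of "h x - h a" c], of "h y"]
      by (simp add: mem_coset_iff[OF N] algebra_simps scale_right_diff_distrib)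
  qed
  then show ?thesis
    using self_mem_coset[OF N a] by (fastforce simp: ks_quotient_def coset_def)
qed

lemma quotient_act:
  assumes N: "ks_submodule M N" and a: "a \<in> carr M"
  shows "mact (ks_quotient M N) s (coset N a) = coset N (mact M s a)"
proof -
  note sub = subspace_image_submodule[OF N]
  have "madd M (mact M s x) y \<in> coset N (mact M s a)" if x: "x \<in> coset N a" and y: "y \<in> N" for x y
  proof -
    \<comment> \<open>The action has no counterpart on the ambient space, so \<open>x\<close> is
      written as \<open>a\<close> plus an element of \<open>N\<close>, and additivity of the action
      is applied inside \<open>M\<close>.\<close>
    obtain p where p: "p \<in> N" "x = madd M a p" using x by (auto simp: coset_def)
    have pc: "p \<in> carr M" "y \<in> carr M" "mact M s p \<in> N" using p y N by (auto simp: ks_submodule_def)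
    then show ?thesis
      using p y a subspace_add[OF sub, of "h (mact M s p)" "h y"]
      by (simp add: mem_coset_iff[OF N] act_add algebra_simps)
  qed
  then show ?thesis
    using self_mem_coset[OF N a] by (fastforce simp: ks_quotient_def coset_def)
qed

lemmas quotient_simps = quotient_carr quotient_mzero quotient_add quotient_smul quotient_act

text \<open>The correspondence theorem: image and preimage under the coset map match the submodules
  of the quotient with the submodules of \<open>M\<close> that contain \<open>N\<close>. Simplicity
  of the quotient thus becomes maximality of \<open>N\<close>.\<close>

lemma simple_quotient_iff:
  assumes N: "ks_submodule M N"
  shows "ks_simple (ks_quotient M N) \<longleftrightarrow>
    N \<noteq> carr M \<and> (\<forall>P. ks_submodule M P \<and> N \<subseteq> P \<longrightarrow> P = N \<or> P = carr M)"
proof -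
  have Nc: "N \<subseteq> carr M" using N by (simp add: ks_submodule_def)
  have carr_eq: "carr (ks_quotient M N) = {N} \<longleftrightarrow> N = carr M"
  proof
    assume "carr (ks_quotient M N) = {N}"
    then have "coset N a = N" if "a \<in> carr M" for a
      using that by (auto simp: quotient_carr)
    then show "N = carr M" using Nc coset_eq_self_iff[OF N] by blast
  next
    assume "N = carr M"
    then have "coset N a = N" if "a \<in> carr M" for a
      using that coset_eq_self_iff[OF N] by blast
    then show "carr (ks_quotient M N) = {N}" using zero_carr
      by (auto simp: quotient_carr simp del: zero_carr)
  qed
  have image: "ks_submodule (ks_quotient M N) (coset N ` P)"
    if P: "ks_submodule M P" for P
  proof -
    have Pc: "x \<in> carr M" if "x \<in> P" for x using that P by (auto simp: ks_submodule_def)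
    have "N \<in> coset N ` P" using coset_mzero[OF N] P by (metis imageI ks_submodule_def)
    moreover have "madd M x y \<in> P" "msmul M c x \<in> P" "mact M s x \<in> P"
      if "x \<in> P" "y \<in> P" for x y c s
      using that P by (auto simp: ks_submodule_def)
    ultimately show ?thesis
      unfolding ks_submodule_def by (auto simp: quotient_simps N Pc)
  qed
  have preimage: "ks_submodule M {a \<in> carr M. coset N a \<in> Q}"
    if Q: "ks_submodule (ks_quotient M N) Q" for Q
  proof -
    have "coset N (madd M x y) \<in> Q" "coset N (msmul M c x) \<in> Q" "coset N (mact M s x) \<in> Q"
      if "x \<in> carr M" "y \<in> carr M" "coset N x \<in> Q" "coset N y \<in> Q" for x y c s
      using Q that unfolding ks_submodule_def
      by (metis quotient_add[OF N] quotient_smul[OF N] quotient_act[OF N])+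
    moreover have "N \<in> Q" using Q by (simp add: ks_submodule_def quotient_mzero)
    ultimately show ?thesis
      unfolding ks_submodule_def by (auto simp: coset_mzero N)
  qed
  show ?thesis
  proof
    assume simple: "ks_simple (ks_quotient M N)"
    have "P = N \<or> P = carr M" if P: "ks_submodule M P" and NP: "N \<subseteq> P" for P
    proof -
      have Pc: "P \<subseteq> carr M" using P by (simp add: ks_submodule_def)
      have "coset N ` P = {N} \<or> coset N ` P = coset N ` carr M"
        using spec[OF simple[unfolded ks_simple_def quotient_carr quotient_mzero, THEN conjunct2],
            of "coset N ` P"] image[OF P]
        by (rule mp)
      then show ?thesis
      proof
        assume 1: "coset N ` P = {N}"
        have "a \<in> N" if a: "a \<in> P" for a
        proof -
          have "coset N a = N" using imageI[OF a, of "coset N"] by (simp only: 1 singleton_iff)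
          then show ?thesis using coset_eq_self_iff[OF N, of a] Pc a by (simp add: subset_eq)
        qed
        then show ?thesis using NP by blast
      next
        assume 2: "coset N ` P = coset N ` carr M"
        have "a \<in> P" if a: "a \<in> carr M" for a
        proof -
          obtain p where p: "p \<in> P" "coset N a = coset N p"
            using imageI[OF a, of "coset N"] unfolding 2[symmetric] by (rule imageE) metis
          then have "a \<in> coset N p" using self_mem_coset[OF N a] by simp
          then obtain x where "x \<in> N" "a = madd M p x" by (auto simp: coset_def)
          then show ?thesis using p NP P by (auto simp: ks_submodule_def)
        qed
        then show ?thesis using Pc by blast
      qed
    qed
    then show "N \<noteq> carr M \<and> (\<forall>P. ks_submodule M P \<and> N \<subseteq> P \<longrightarrow> P = N \<or> P = carr M)"
      using simple carr_eq by (simp add: ks_simple_def quotient_mzero)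
  next
    assume max: "N \<noteq> carr M \<and> (\<forall>P. ks_submodule M P \<and> N \<subseteq> P \<longrightarrow> P = N \<or> P = carr M)"
    have "Q = {N} \<or> Q = carr (ks_quotient M N)" if Q: "ks_submodule (ks_quotient M N) Q" for Q
    proof -
      let ?P = "{a \<in> carr M. coset N a \<in> Q}"
      have NQ: "N \<in> Q" "Q \<subseteq> coset N ` carr M" using Q by (auto simp: ks_submodule_def quotient_simps)
      then have Qe: "Q = coset N ` ?P" by auto
      have "N \<subseteq> ?P"
      proof
        fix a assume a: "a \<in> N"
        then have "coset N a = N" using coset_eq_self_iff[OF N, of a] Nc by (simp add: subset_eq)
        then show "a \<in> ?P" using a Nc NQ by auto
      qed
      then consider "?P = N" | "?P = carr M" using max preimage[OF Q] by meson
      then show ?thesis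
      proof cases
        case 1
        have "A = N" if "A \<in> Q" for A
          using that Qe 1 coset_eq_self_iff[OF N] Nc by auto
        then show ?thesis using NQ by blast
      next
        case 2
        then show ?thesis using Qe by (simp add: quotient_carr)
      qed
    qed
    then show "ks_simple (ks_quotient M N)"
      using max carr_eq by (auto simp: ks_simple_def quotient_mzero)
  qed
qed

text \<open>The homomorphism theorem: a linear map whose kernel on the image of \<open>M\<close> is
  the image of \<open>N\<close> is constant on cosets and separates them. It keeps quotients inside
  a vector space on a whole type; for tensor powers the map is \<open>expand\<close>.\<close>

lemma embedded_quotient:
  assumes N: "ks_submodule M N"
    and lin: "Vector_Spaces.linear scale scale \<Phi>"
    and ker: "\<And>x. x \<in> carr M \<Longrightarrow> \<Phi> (h x) = 0 \<longleftrightarrow> x \<in> N"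
  shows "\<exists>h'. embedded_ks_module scale (ks_quotient M N) h' \<and> (\<forall>x\<in>carr M. h' (coset N x) = \<Phi> (h x))"
proof -
  interpret lin: Vector_Spaces.linear scale scale \<Phi> by (fact lin)
  \<comment> \<open>A representative is chosen; \<open>const\<close> shows that its choice does not
    affect the value.\<close>
  define h' where "h' A = \<Phi> (h (SOME a. a \<in> A))" for A
  have const: "\<Phi> (h x) = \<Phi> (h y)" if "coset N x = coset N y" "x \<in> carr M" "y \<in> carr M" for x y
  proof -
    have "h x - h y \<in> h ` N" using that coset_eq_iff[OF N] by blast
    then obtain z where z: "z \<in> N" "h x - h y = h z" by auto
    then have "\<Phi> (h z) = 0" using ker N by (auto simp: ks_submodule_def)
    then show ?thesis using z by (metis lin.diff right_minus_eq)
  qed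
  have h': "h' (coset N x) = \<Phi> (h x)" if x: "x \<in> carr M" for x
  proof -
    have "(SOME a. a \<in> coset N x) \<in> coset N x" using self_mem_coset[OF N x] by (rule someI)
    then have "(SOME a. a \<in> coset N x) \<in> carr M" "coset N (SOME a. a \<in> coset N x) = coset N x"
      using x coset_eq_iff[OF N] mem_coset_iff[OF N] by auto
    then show ?thesis using x const unfolding h'_def by blast
  qed
  have eqI: "coset N x = coset N y" if "\<Phi> (h x) = \<Phi> (h y)" and x: "x \<in> carr M" and y: "y \<in> carr M" for x y
  proof -
    let ?z = "madd M x (msmul M (-1) y)"
    have z: "h ?z = h x - h y" using x y by simp
    then have "?z \<in> N" using ker[of ?z] that by (simp add: lin.diff)
    then show ?thesis using z x y by (metis coset_eq_iff[OF N] imageI)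
  qed
  have inj: "inj_on h' (coset N ` carr M)"
  proof (rule inj_onI)
    fix A B assume "A \<in> coset N ` carr M" "B \<in> coset N ` carr M" "h' A = h' B"
    then obtain x y where "x \<in> carr M" "y \<in> carr M" "A = coset N x" "B = coset N y" by (elim imageE)
    then show "A = B" using eqI[of x y] \<open>h' A = h' B\<close> by (simp add: h')
  qed
  have h'N: "h' N = 0" using h'[OF zero_carr] coset_mzero[OF N] by (simp add: lin.zero)
  have NQ: "N \<in> coset N ` carr M" using coset_mzero[OF N] by (metis imageI zero_carr)
  have "embedded_ks_module scale (ks_quotient M N) h'"
    \<comment> \<open>Every element of the quotient is a coset, so each module law is checked on
      representatives.\<close>
    by unfold_locales
      (unfold quotient_carr quotient_mzero, (rule inj h'N NQ |
        (elim imageE, simp add: quotient_simps N imageI[of _ _ "coset N"] h' lin.add lin.scale act_add act_smul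
          del: image_iff))+)
  then show ?thesis using h' by blast
qed

section \<open>Simple factors, chains of submodules and bounds on their length\<close>

lemma simple_factor_iff:
  assumes X: "ks_submodule M X" and Y: "ks_submodule M Y" and XY: "X \<subseteq> Y"
  shows "ks_simple (ks_factor M Y X) \<longleftrightarrow>
    X \<noteq> Y \<and> (\<forall>P. ks_submodule M P \<and> X \<subseteq> P \<and> P \<subseteq> Y \<longrightarrow> P = X \<or> P = Y)"
proof -
  interpret Y: embedded_ks_module scale "M\<lparr>carr := Y\<rparr>" h by (rule embedded_submodule[OF Y])
  have sub: "ks_submodule (M\<lparr>carr := Y\<rparr>) P \<longleftrightarrow> ks_submodule M P \<and> P \<subseteq> Y" for P
    using Y by (auto simp: ks_submodule_def)
  show ?thesis
    unfolding ks_factor_def using Y.simple_quotient_iff[of X] X XY by (auto simp: sub)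
qed

text \<open>Each strict inclusion supplies a vector outside the span of those already chosen, so
  \<open>Ns ! i\<close> contains \<open>i\<close> independent vectors. The last index is
  \<open>length Ns - 1\<close>, whence the bound \<open>Suc (card E)\<close>.\<close>

lemma strict_chain_length:
  assumes sub: "\<And>N. N \<in> set Ns \<Longrightarrow> ks_submodule M N"
    and strict: "\<And>i. Suc i < length Ns \<Longrightarrow> Ns ! i \<subset> Ns ! Suc i"
    and E: "finite E" "h ` carr M \<subseteq> span E"
  shows "length Ns \<le> Suc (card E)"
proof -
  have "\<exists>I. finite I \<and> independent I \<and> I \<subseteq> h ` (Ns ! i) \<and> card I = i" if "i < length Ns" for i
    using that
  proof (induction i)
    case 0
    show ?case by (rule exI[of _ "{}"]) (simp add: independent_empty)
  next
    case (Suc i)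
    then obtain I where I: "finite I" "independent I" "I \<subseteq> h ` (Ns ! i)" "card I = i" by auto
    have Ni: "ks_submodule M (Ns ! i)" "ks_submodule M (Ns ! Suc i)" using sub Suc.prems by auto
    obtain x where x: "x \<in> Ns ! Suc i" "x \<notin> Ns ! i" using strict[OF Suc.prems] by blast
    have "h x \<notin> h ` (Ns ! i)"
      using x Ni h_in_image_iff by (meson ks_submodule_def subsetD)
    then have "h x \<notin> span I"
      using span_minimal[OF I(3) subspace_image_submodule[OF Ni(1)]] by blast
    then have "independent (insert (h x) I)" "h x \<notin> I"
      using I independent_insertI span_base by auto
    then show ?case
      using I x strict[OF Suc.prems] by (intro exI[of _ "insert (h x) I"]) auto
  qed
  note I = this
  show ?thesis
  proof (cases "Ns = []")
    case False
    then obtain I where I: "independent I" "I \<subseteq> h ` (Ns ! (length Ns - 1))" "card I = length Ns - 1"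
      using I[of "length Ns - 1"] by auto
    have "Ns ! (length Ns - 1) \<subseteq> carr M" using False sub[of "Ns ! (length Ns - 1)"] by (simp add: ks_submodule_def)
    then have "I \<subseteq> span E" using I E by blast
    then have "card I \<le> card E" using independent_span_bound[OF E(1) I(1)] by blast
    then show ?thesis using I False by linarith
  qed simp
qed

lemma composition_series_step:
  assumes "composition_series M Ns" "Suc i < length Ns"
  shows "ks_submodule M (Ns ! i)" "ks_submodule M (Ns ! Suc i)" "Ns ! i \<subset> Ns ! Suc i"
    "\<And>P. \<lbrakk>ks_submodule M P; Ns ! i \<subseteq> P; P \<subseteq> Ns ! Suc i\<rbrakk> \<Longrightarrow> P = Ns ! i \<or> P = Ns ! Suc i"
proof -
  show sub: "ks_submodule M (Ns ! i)" "ks_submodule M (Ns ! Suc i)"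
    using assms by (auto simp: composition_series_def)
  have le: "Ns ! i \<subseteq> Ns ! Suc i" and simple: "ks_simple (ks_factor M (Ns ! Suc i) (Ns ! i))"
    using assms by (auto simp: composition_series_def)
  show "Ns ! i \<subset> Ns ! Suc i"
    "\<And>P. \<lbrakk>ks_submodule M P; Ns ! i \<subseteq> P; P \<subseteq> Ns ! Suc i\<rbrakk> \<Longrightarrow> P = Ns ! i \<or> P = Ns ! Suc i"
    using simple le by (auto simp: simple_factor_iff[OF sub le])
qed

lemma composition_series_length_le:
  assumes "composition_series M Ns" "finite E" "h ` carr M \<subseteq> span E"
  shows "length Ns \<le> Suc (card E)"
  using assms composition_series_step[OF assms(1)]
  by (intro strict_chain_length) (auto simp: composition_series_def)

text \<open>
  If an annihilated vector \<open>x\<close> lies in \<open>N\<^bsub>i+1\<^esub>\<close> but not in \<open>N\<^sub>i\<close>, then \<open>N\<^sub>i + kx\<close> is a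
  submodule, hence equal to \<open>N\<^bsub>i+1\<^esub>\<close>; so each step absorbs at most one dimension of annihilated
  vectors.
\<close>

lemma composition_series_length_ge:
  assumes cs: "composition_series M Ns"
    and I: "independent (h ` I)" "inj_on h I" "I \<subseteq> carr M"
    and killed: "\<And>x s. x \<in> I \<Longrightarrow> mact M s x = mzero M"
  shows "card I < length Ns"
proof -
  define K where "K = {x \<in> carr M. \<forall>s. mact M s x = mzero M}"
  \<comment> \<open>Invariant: the annihilated vectors in \<open>Ns ! i\<close> lie in the span of
    at most \<open>i\<close> vectors. At the last index this bounds all annihilated vectors of
    \<open>M\<close>.\<close>
  have "\<exists>G. finite G \<and> card G \<le> i \<and> h ` (K \<inter> Ns ! i) \<subseteq> span G" if "i < length Ns" for i
    using that
  proof (induction i)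
    case 0
    have "Ns ! 0 = {mzero M}" using cs 0 by (auto simp: composition_series_def hd_conv_nth)
    then show ?case by (intro exI[of _ "{}"]) auto
  next
    case (Suc i)
    then obtain G where G: "finite G" "card G \<le> i" "h ` (K \<inter> Ns ! i) \<subseteq> span G" by auto
    note step = composition_series_step[OF cs Suc.prems]
    let ?N = "Ns ! i" and ?N' = "Ns ! Suc i"
    have sub: "?N \<subseteq> carr M" "?N' \<subseteq> carr M" using step(1,2) by (auto simp: ks_submodule_def)
    show ?case
    proof (cases "K \<inter> ?N' \<subseteq> ?N")
      case True
      then have "h ` (K \<inter> ?N') \<subseteq> span G" using G by blast
      then show ?thesis using G by (intro exI[of _ G]) auto
    next
      case False
      then obtain x where x: "x \<in> K" "x \<in> ?N'" "x \<notin> ?N" by blast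
      then have xc: "x \<in> carr M" and xk: "mact M s x = mzero M" for s by (auto simp: K_def)
      define P where "P = {y \<in> carr M. \<exists>n\<in>?N. \<exists>c. h y = h n + scale c (h x)}"
      have PI: "y \<in> P" if "y \<in> carr M" "n \<in> ?N" "h y = h n + scale c (h x)" for y n c
        using that by (auto simp: P_def)
      have NP: "n \<in> P" if "n \<in> ?N" for n
        using that sub by (auto simp: P_def intro!: bexI[of _ n] exI[of _ 0])
      have nc: "n \<in> carr M" if "n \<in> ?N" for n using that sub by auto
      have "ks_submodule M P"
        unfolding ks_submodule_def
      proof (intro conjI ballI allI)
        show "P \<subseteq> carr M" by (auto simp: P_def)
        show "mzero M \<in> P" using NP step(1) by (auto simp: ks_submodule_def)
      next
        fix y z assume "y \<in> P" "z \<in> P"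
        then obtain n c n' c' where *: "n \<in> ?N" "h y = h n + scale c (h x)" "n' \<in> ?N" 
          "h z = h n' + scale c' (h x)" "y \<in> carr M" "z \<in> carr M"
          by (auto simp: P_def)
        then have "h (madd M y z) = h (madd M n n') + scale (c + c') (h x)"
          using nc by (simp add: algebra_simps)
        moreover have "madd M n n' \<in> ?N" using * step(1) by (auto simp: ks_submodule_def)
        ultimately show "madd M y z \<in> P" using * by (intro PI) auto
      next
        fix y d assume "y \<in> P"
        then obtain n c where *: "n \<in> ?N" "h y = h n + scale c (h x)" "y \<in> carr M"
          by (auto simp: P_def)
        then have "h (msmul M d y) = h (msmul M d n) + scale (d * c) (h x)"
          using nc by (simp add: algebra_simps)
        moreover have "msmul M d n \<in> ?N" using * step(1) by (auto simp: ks_submodule_def)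
        ultimately show "msmul M d y \<in> P" using * by (intro PI) auto
      next
        fix y s assume "y \<in> P"
        then obtain n c where *: "n \<in> ?N" "h y = h n + scale c (h x)" "y \<in> carr M"
          by (auto simp: P_def)
        then have "y = madd M n (msmul M c x)" using nc xc by (simp add: eq_iff_h)
        then have "mact M s y = mact M s n"
          using * nc xc by (simp add: act_add act_smul xk smul_zero add_zero)
        then show "mact M s y \<in> P" using * step(1) NP by (auto simp: ks_submodule_def)
      qed
      moreover have "P \<subseteq> ?N'"
      proof
        fix y assume "y \<in> P"
        then obtain n c where *: "n \<in> ?N" "h y = h n + scale c (h x)" "y \<in> carr M"
          by (auto simp: P_def)
        then have "y = madd M n (msmul M c x)" using nc xc by (simp add: eq_iff_h)
        then show "y \<in> ?N'" using * x step(2,3) by (auto simp: ks_submodule_def)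
      qed
      moreover have "x \<in> P" using xc step(1)
        by (auto simp: P_def ks_submodule_def intro!: bexI[of _ "mzero M"] exI[of _ 1])
      ultimately have P: "P = ?N'" using step(4)[of P] NP x by blast
      have "h y \<in> span (insert (h x) G)" if y: "y \<in> K" "y \<in> ?N'" for y
      proof -
        obtain n c where *: "n \<in> ?N" "h y = h n + scale c (h x)" "y \<in> carr M"
          using y unfolding P[symmetric] by (auto simp: P_def)
        \<comment> \<open>Subtracting the annihilated multiple of \<open>x\<close> from the
          annihilated \<open>y\<close> leaves an annihilated vector of \<open>Ns ! i\<close>, to
          which the induction hypothesis applies.\<close>
        then have "n = madd M y (msmul M (- c) x)" using nc xc by (simp add: eq_iff_h)
        then have "mact M s n = mzero M" for s
          using * y xc by (simp add: act_add act_smul xk smul_zero add_zero) (simp add: K_def)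
        then have "n \<in> K" using * nc by (simp add: K_def)
        then have "h n \<in> span G" using * G by blast
        then show ?thesis using * by (auto simp: span_breakdown_eq intro!: exI[of _ c])
      qed
      moreover have "card (insert (h x) G) \<le> Suc i" using G by (simp add: card_insert_if)
      ultimately show ?thesis using G by (intro exI[of _ "insert (h x) G"]) auto
    qed
  qed
  moreover have ne: "Ns \<noteq> []" "last Ns = carr M" using cs by (auto simp: composition_series_def)
  ultimately obtain G where G: "finite G" "card G \<le> length Ns - 1" "h ` (K \<inter> carr M) \<subseteq> span G"
    using last_conv_nth[OF ne(1)] by (metis diff_less length_greater_0_conv zero_less_one)
  have "I \<subseteq> K \<inter> carr M" using I killed by (auto simp: K_def)
  then have "h ` I \<subseteq> span G" using G(3) by blast
  then have "card (h ` I) \<le> card G" using independent_span_bound[OF G(1) I(1)] by blast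
  moreover have "0 < length Ns" using ne by simp
  ultimately show ?thesis using G(2) card_image[OF I(2)] by linarith
qed

text \<open>Chain lengths are bounded by dimension, so some strict chain from zero to
  \<open>M\<close> through \<open>K\<close> has maximal length. A submodule strictly between two
  neighbours could be inserted, so all factors are simple. With \<open>K\<close> zero this gives
  existence of composition series.\<close>

lemma composition_series_through:
  assumes K: "ks_submodule M K" and E: "finite E" "h ` carr M \<subseteq> span E"
  shows "\<exists>Ns. composition_series M Ns \<and> K \<in> set Ns"
proof -
  define chain where "chain Ns \<longleftrightarrow> Ns \<noteq> [] \<and> hd Ns = {mzero M} \<and> last Ns = carr M \<and> K \<in> set Ns \<and>
     (\<forall>N\<in>set Ns. ks_submodule M N) \<and> sorted_wrt (\<subset>) Ns" for Ns
  have bound: "length Ns \<le> Suc (card E)" if "chain Ns" for Ns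
    using that E by (intro strict_chain_length) (auto simp: chain_def sorted_wrt_iff_nth_less)
  \<comment> \<open>A strict chain has no repeated terms, so coincidences among zero,
    \<open>K\<close> and \<open>carr M\<close> are separated first.\<close>
  have "\<exists>Ns. chain Ns"
  proof (cases "K = {mzero M} \<or> K = carr M")
    case True
    show ?thesis
    proof (cases "carr M = {mzero M}")
      case True
      then show ?thesis using K by (intro exI[of _ "[K]"]) (auto simp: chain_def ks_submodule_def)
    next
      case False
      then show ?thesis using \<open>K = {mzero M} \<or> K = carr M\<close> submodule_zero submodule_carr zero_carr
        by (intro exI[of _ "[{mzero M}, carr M]"]) (auto simp: chain_def)
    qed
  next
    case False
    then show ?thesis using K submodule_zero submodule_carr zero_carr
      by (intro exI[of _ "[{mzero M}, K, carr M]"]) (auto simp: chain_def ks_submodule_def)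
  qed
  then obtain Ns where Ns: "chain Ns" and max: "\<And>Ns'. chain Ns' \<Longrightarrow> length Ns' \<le> length Ns"
    using ex_has_greatest_nat[of chain _ length "Suc (Suc (card E))"] bound
    by (metis le_imp_less_Suc)
  have "ks_simple (ks_factor M (Ns ! Suc i) (Ns ! i))" if i: "Suc i < length Ns" for i
  proof -
    have sub: "ks_submodule M (Ns ! i)" "ks_submodule M (Ns ! Suc i)" and lt: "Ns ! i \<subset> Ns ! Suc i"
      using i Ns by (auto simp: chain_def sorted_wrt_iff_nth_less)
    have "P = Ns ! i \<or> P = Ns ! Suc i"
      if P: "ks_submodule M P" "Ns ! i \<subseteq> P" "P \<subseteq> Ns ! Suc i" for P
    proof (rule ccontr)
      assume "\<not> (P = Ns ! i \<or> P = Ns ! Suc i)"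
      then have P': "Ns ! i \<subset> P" "P \<subset> Ns ! Suc i" using P by auto
      \<comment> \<open>The chain is cut just after index \<open>i\<close>; placing \<open>P\<close>
        at the cut yields a longer chain, against maximality.\<close>
      define xs ys where "xs = take (Suc i) Ns" and "ys = drop (Suc i) Ns"
      have split: "Ns = xs @ ys" by (simp add: xs_def ys_def)
      have sorted: "sorted_wrt (\<subset>) xs" "sorted_wrt (\<subset>) ys" "\<And>x y. x \<in> set xs \<Longrightarrow> y \<in> set ys \<Longrightarrow> x \<subset> y"
        using Ns by (auto simp: chain_def split sorted_wrt_append)
      have mono: "Ns ! k \<subseteq> Ns ! l" if "k \<le> l" "l < length Ns" for k l
        using Ns that by (cases "k = l") (simp_all add: chain_def sorted_wrt_iff_nth_less psubset_imp_subset)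
      have "x \<subset> P" if "x \<in> set xs" for x
      proof -
        obtain k where "k \<le> i" "x = Ns ! k" using \<open>x \<in> set xs\<close> by (auto simp: xs_def in_set_conv_nth less_Suc_eq_le)
        then show ?thesis using mono[of k i] i P' by auto
      qed
      moreover have "P \<subset> y" if "y \<in> set ys" for y
      proof -
        obtain k where k: "k < length Ns - Suc i" "y = Ns ! (Suc i + k)"
          using \<open>y \<in> set ys\<close> i by (auto simp: ys_def in_set_conv_nth)
        then have "Suc i + k < length Ns" by linarith
        with k show ?thesis using mono[of "Suc i" "Suc i + k"] P' by auto
      qed
      moreover have "xs \<noteq> []" "ys \<noteq> []" using i by (auto simp: xs_def ys_def)
      ultimately have "chain (xs @ P # ys)"
        using Ns sorted P(1) by (auto simp: chain_def split sorted_wrt_append)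
      from max[OF this] show False by (simp add: split)
    qed
    then show ?thesis using lt by (auto simp: simple_factor_iff[OF sub])
  qed
  then have "composition_series M Ns"
    using Ns by (simp add: composition_series_def chain_def sorted_wrt_iff_nth_less psubset_imp_subset)
  then show ?thesis using Ns by (auto simp: chain_def)
qed

text \<open>The line \<open>K\<close> spanned by an annihilated nonzero \<open>x\<close> is a
  submodule. In a series through \<open>K\<close> the preceding term must be zero, and the factor
  there is the null module.\<close>

lemma null_composition_factor:
  assumes x: "x \<in> carr M" "x \<noteq> mzero M" and killed: "\<And>s. mact M s x = mzero M"
    and E: "finite E" "h ` carr M \<subseteq> span E"
  shows "composition_factor null_module M"
proof -
  define K where "K = range (\<lambda>c. msmul M c x)"
  have hx: "h x \<noteq> 0" using x by (metis eq_iff_h h_zero zero_carr)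
  have Kc: "K \<subseteq> carr M" using x by (auto simp: K_def)
  have addK: "madd M (msmul M c x) (msmul M d x) = msmul M (c + d) x" for c d
    using x by (simp add: eq_iff_h algebra_simps)
  have smulK: "msmul M c (msmul M d x) = msmul M (c * d) x" for c d
    using x by (simp add: eq_iff_h)
  have actK: "mact M s (msmul M c x) = mzero M" for s c
    using x by (simp add: act_smul killed smul_zero)
  have K: "ks_submodule M K"
    unfolding ks_submodule_def using Kc smul_0[OF x(1)]
    by (auto simp: K_def addK smulK actK intro: range_eqI[of _ _ 0])
  then obtain Ns where cs: "composition_series M Ns" and "K \<in> set Ns"
    using composition_series_through E by blast
  then obtain j where j: "j < length Ns" "Ns ! j = K" by (auto simp: in_set_conv_nth)
  have xK: "x \<in> K" using x by (auto simp: K_def eq_iff_h intro!: range_eqI[of _ _ 1])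
  have "Ns ! 0 = {mzero M}" using cs by (auto simp: composition_series_def hd_conv_nth)
  then have "j \<noteq> 0" using j x xK by (metis singletonD)
  then obtain i where i: "j = Suc i" using not0_implies_Suc by blast
  note step = composition_series_step[OF cs, of i]
  \<comment> \<open>A nonzero vector of \<open>Ns ! i\<close> is a nonzero multiple of
    \<open>x\<close>, so its multiples fill \<open>K\<close>, contradicting strict inclusion in
    \<open>K\<close>.\<close>
  have "Ns ! i = {mzero M}"
  proof -
    have "y = mzero M" if y: "y \<in> Ns ! i" for y
    proof (rule ccontr)
      assume "y \<noteq> mzero M"
      have "y \<in> K" using y step(3) j i by auto
      then obtain c where c: "y = msmul M c x" by (auto simp: K_def)
      then have "c \<noteq> 0" using \<open>y \<noteq> mzero M\<close> x by (auto simp: smul_0)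
      then have "msmul M d x = msmul M (d / c) y" for d by (simp add: c smulK)
      then have "msmul M d x \<in> Ns ! i" for d using y step(1) j i by (auto simp: ks_submodule_def)
      then have "K \<subseteq> Ns ! i" by (auto simp: K_def)
      then show False using step(3) j i by auto
    qed
    moreover have "mzero M \<in> Ns ! i" using step(1) j i by (auto simp: ks_submodule_def)
    ultimately show ?thesis by blast
  qed
  interpret K: embedded_ks_module scale "M\<lparr>carr := K\<rparr>" h by (rule embedded_submodule[OF K])
  let ?Z = "{mzero M}"
  have Z: "ks_submodule (M\<lparr>carr := K\<rparr>) ?Z" using K.submodule_zero by simp
  let ?Q = "ks_factor M K ?Z"
  \<comment> \<open>Cosets of the zero submodule are singletons, so \<open>g\<close> is a bijection
    from the field onto the factor; its inverse is the isomorphism sought.\<close>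
  define g where "g c = K.coset ?Z (msmul M c x)" for c
  have mK: "msmul M c x \<in> carr (M\<lparr>carr := K\<rparr>)" for c by (simp add: K_def)
  have g_eq: "g c = {msmul M c x}" for c
    using x by (simp add: g_def K.coset_def add_zero)
  have inj_g: "inj g"
    using x hx by (auto simp: inj_def g_eq eq_iff_h)
  have carrQ: "carr ?Q = range g"
    unfolding ks_factor_def K.quotient_carr by (auto simp: g_def K_def)
  have "bij_betw (inv g) (carr ?Q) UNIV"
    unfolding carrQ by (simp add: bij_betw_def inj_g inj_on_inv_into surjI)
  moreover have "inv g (madd ?Q (g c) (g d)) = c + d" for c d
    using K.quotient_add[OF Z mK mK, of c d] addK inv_f_f[OF inj_g] by (simp add: g_def ks_factor_def)
  moreover have "inv g (msmul ?Q c (g d)) = c * d" for c d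
    using K.quotient_smul[OF Z mK, of c d] smulK inv_f_f[OF inj_g] by (simp add: g_def ks_factor_def)
  moreover have "inv g (mact ?Q s (g d)) = 0" for s d
    using K.quotient_act[OF Z mK, of s d] actK inv_f_f[OF inj_g, of 0]
    by (simp add: g_def ks_factor_def smul_0 x)
  ultimately have "ks_isomorphic ?Q null_module"
    unfolding ks_isomorphic_def
    by (intro exI[of _ "inv g"]) (auto simp: carrQ null_module_def inv_f_f[OF inj_g])
  then show ?thesis
    unfolding composition_factor_def using cs j i \<open>Ns ! i = ?Z\<close>
    by (intro exI[of _ Ns] exI[of _ i]) simp
qed

end

subsection \<open>Tensor powers\<close>

lemma lookup_free_smul [simp]: "Poly_Mapping.lookup (free_smul c f) a = c * Poly_Mapping.lookup f a"
  by (simp add: free_smul_def Poly_Mapping.map.rep_eq when_def)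

lemma vector_space_free_smul: "vector_space (free_smul :: 'k::field \<Rightarrow> ('b \<Rightarrow>\<^sub>0 'k) \<Rightarrow> _)"
  by unfold_locales (auto intro!: poly_mapping_eqI simp: lookup_add algebra_simps)

interpretation free: vector_space "free_smul :: 'k::field \<Rightarrow> ('b \<Rightarrow>\<^sub>0 'k) \<Rightarrow> _"
  by (rule vector_space_free_smul)

lemma free_smul_single: "free_smul c (Poly_Mapping.single a d) = Poly_Mapping.single a (c * d)"
  by (rule poly_mapping_eqI) (simp add: lookup_single when_def)

lemma keys_free_smul: "Poly_Mapping.keys (free_smul c f) \<subseteq> Poly_Mapping.keys f"
  by (auto simp: in_keys_iff)

text \<open>The linear extension of a map prescribed on the standard basis
  \<open>Poly_Mapping.single a 1\<close>.\<close>

definition free_ext :: "('a \<Rightarrow> 'b \<Rightarrow>\<^sub>0 'k::field) \<Rightarrow> ('a \<Rightarrow>\<^sub>0 'k) \<Rightarrow> 'b \<Rightarrow>\<^sub>0 'k" where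
  "free_ext g f = (\<Sum>a\<in>Poly_Mapping.keys f. free_smul (Poly_Mapping.lookup f a) (g a))"

text \<open>Summing over a common finite superset of the supports lets the extensions of several
  elements be compared term by term.\<close>

lemma free_ext_superset:
  assumes "finite A" "Poly_Mapping.keys f \<subseteq> A"
  shows "free_ext g f = (\<Sum>a\<in>A. free_smul (Poly_Mapping.lookup f a) (g a))"
  unfolding free_ext_def using assms
  by (intro sum.mono_neutral_left) (auto simp: in_keys_iff)

lemma linear_free_ext:
  fixes g :: "'a \<Rightarrow> 'b \<Rightarrow>\<^sub>0 'k::field"
  shows "Vector_Spaces.linear free_smul free_smul (free_ext g)"
proof unfold_locales
  fix f1 f2 :: "'a \<Rightarrow>\<^sub>0 'k"
  let ?A = "Poly_Mapping.keys f1 \<union> Poly_Mapping.keys f2"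
  have "Poly_Mapping.keys (f1 + f2) \<subseteq> ?A" by (rule Poly_Mapping.keys_add)
  then show "free_ext g (f1 + f2) = free_ext g f1 + free_ext g f2"
    by (simp add: free_ext_superset[of ?A] lookup_add free.scale_left_distrib sum.distrib)
next
  fix c and f :: "'a \<Rightarrow>\<^sub>0 'k"
  show "free_ext g (free_smul c f) = free_smul c (free_ext g f)"
    using keys_free_smul[of c f]
    by (simp add: free_ext_superset[of "Poly_Mapping.keys f"] free.scale_sum_right)
qed

lemma free_ext_single: "free_ext g (Poly_Mapping.single a c) = free_smul c (g a)"
  by (cases "c = 0") (simp_all add: free_ext_def)

lemma free_ext_id: "free_ext (\<lambda>a. Poly_Mapping.single a 1) f = f"
proof (rule poly_mapping_eqI)
  fix b
  have "(\<Sum>a\<in>Poly_Mapping.keys f. Poly_Mapping.lookup f a * (if a = b then 1 else 0)) = Poly_Mapping.lookup f b"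
    by (simp add: if_distrib[of "(*) _"] in_keys_iff cong: if_cong)
  then show "Poly_Mapping.lookup (free_ext (\<lambda>a. Poly_Mapping.single a 1) f) b = Poly_Mapping.lookup f b"
    by (simp add: free_ext_def lookup_sum lookup_single when_def)
qed

text \<open>The coordinate at \<open>a\<close> vanishes on the other standard basis vectors, hence
  on their span, but not on \<open>Poly_Mapping.single a 1\<close>.\<close>

lemma independent_single: "free.independent ((\<lambda>a. Poly_Mapping.single a (1::'k::field)) ` A)"
  unfolding free.dependent_def
proof
  assume "\<exists>x\<in>(\<lambda>a. Poly_Mapping.single a (1::'k)) ` A.
    x \<in> free.span ((\<lambda>a. Poly_Mapping.single a 1) ` A - {x})"
  then obtain a where a: "Poly_Mapping.single a (1::'k) \<in>
    free.span ((\<lambda>a. Poly_Mapping.single a 1) ` A - {Poly_Mapping.single a 1})" by blast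
  have "free.subspace {f :: 'a \<Rightarrow>\<^sub>0 'k. Poly_Mapping.lookup f a = 0}"
    by (auto simp: free.subspace_def lookup_add)
  then have "free.span ((\<lambda>a. Poly_Mapping.single a (1::'k)) ` A - {Poly_Mapping.single a 1})
    \<subseteq> {f. Poly_Mapping.lookup f a = 0}"
    by (rule free.span_minimal[rotated]) (auto simp: lookup_single when_def)
  then show False using a by auto
qed

text \<open>The carrier is already a subspace of the free vector space, so the embedding is the
  identity. This makes the quotient theory above available for tensor powers.\<close>

lemma embedded_free_tensor_module:
  fixes \<rho> :: "'s \<Rightarrow> 'v \<Rightarrow> 'v"
  shows "embedded_ks_module free_smul (free_tensor_module \<rho> n :: ('k::field, _, _) ks_module) id"
proof -
  \<comment> \<open>The action is rewritten as a linear extension, from which its linearity is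
    immediate.\<close>
  have act: "mact (free_tensor_module \<rho> n) s f =
      free_ext (\<lambda>vs. Poly_Mapping.single (map (\<rho> s) vs) 1) f" for s and f :: "'v list \<Rightarrow>\<^sub>0 'k"
    by (simp add: free_tensor_module_def free_ext_def free_smul_single)
  interpret act: Vector_Spaces.linear free_smul free_smul
    "free_ext (\<lambda>vs. Poly_Mapping.single (map (\<rho> s) vs) (1::'k))" for s
    by (rule linear_free_ext)
  show ?thesis
  proof unfold_locales
    fix f g :: "'v list \<Rightarrow>\<^sub>0 'k" and s
    assume f: "f \<in> carr (free_tensor_module \<rho> n)"
    then show "mact (free_tensor_module \<rho> n) s f \<in> carr (free_tensor_module \<rho> n)"
      using keys_sum[of "\<lambda>vs. Poly_Mapping.single (map (\<rho> s) vs) (Poly_Mapping.lookup f vs)" "Poly_Mapping.keys f"]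
      by (fastforce simp: free_tensor_module_def split: if_splits)
    assume g: "g \<in> carr (free_tensor_module \<rho> n)"
    show "madd (free_tensor_module \<rho> n) f g \<in> carr (free_tensor_module \<rho> n)"
      using f g Poly_Mapping.keys_add[of f g] by (auto simp: free_tensor_module_def)
  next
    fix f g :: "'v list \<Rightarrow>\<^sub>0 'k" and s
    show "mact (free_tensor_module \<rho> n) s (madd (free_tensor_module \<rho> n) f g) =
      madd (free_tensor_module \<rho> n) (mact (free_tensor_module \<rho> n) s f) (mact (free_tensor_module \<rho> n) s g)"
      unfolding act by (simp add: free_tensor_module_def act.add)
  next
    fix f :: "'v list \<Rightarrow>\<^sub>0 'k" and s c
    show "mact (free_tensor_module \<rho> n) s (msmul (free_tensor_module \<rho> n) c f) =
      msmul (free_tensor_module \<rho> n) c (mact (free_tensor_module \<rho> n) s f)"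
      unfolding act by (simp add: free_tensor_module_def act.scale)
    assume "f \<in> carr (free_tensor_module \<rho> n)"
    then show "msmul (free_tensor_module \<rho> n) c f \<in> carr (free_tensor_module \<rho> n)"
      using keys_free_smul[of c f] by (auto simp: free_tensor_module_def)
  qed (auto simp: free_tensor_module_def)
qed

section \<open>The submodule of multilinearity relations\<close>

abbreviation relations :: "('k::field \<Rightarrow> 'v::ab_group_add \<Rightarrow> 'v) \<Rightarrow> nat \<Rightarrow> ('v list \<Rightarrow>\<^sub>0 'k) set" where
  "relations scale n \<equiv> free.span (multilinear_relators scale n)"

lemma relations_add:
  "length xs + 1 + length ys = n \<Longrightarrow>
    Poly_Mapping.single (xs @ (u + v) # ys) 1 - Poly_Mapping.single (xs @ u # ys) 1
      - Poly_Mapping.single (xs @ v # ys) 1 \<in> relations scale n"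
  by (rule free.span_base) (unfold multilinear_relators_def, blast)

lemma relations_scale:
  "length xs + 1 + length ys = n \<Longrightarrow>
    Poly_Mapping.single (xs @ scale c u # ys) 1 - free_smul c (Poly_Mapping.single (xs @ u # ys) 1)
      \<in> relations scale n"
  by (rule free.span_base) (unfold multilinear_relators_def, blast)

text \<open>The relations are a span, so a linear map needs checking on the generators only. This
  serves twice: for invariance under the action, with \<open>T\<close> the relations, and for the
  vanishing of \<open>expand\<close>, with \<open>T\<close> zero.\<close>

lemma linear_image_relations:
  assumes f: "Vector_Spaces.linear free_smul free_smul f"
    and T: "free.subspace T"
    and add: "\<And>xs ys u v. length xs + 1 + length ys = n \<Longrightarrow>
      f (Poly_Mapping.single (xs @ (u + v) # ys) 1) - f (Poly_Mapping.single (xs @ u # ys) 1)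
        - f (Poly_Mapping.single (xs @ v # ys) 1) \<in> T"
    and scale: "\<And>xs ys c u. length xs + 1 + length ys = n \<Longrightarrow>
      f (Poly_Mapping.single (xs @ scale c u # ys) 1)
        - free_smul c (f (Poly_Mapping.single (xs @ u # ys) 1)) \<in> T"
    and r: "r \<in> relations scale n"
  shows "f r \<in> T"
proof -
  interpret f: Vector_Spaces.linear free_smul free_smul f by (rule f)
  have "relations scale n \<subseteq> {r. f r \<in> T}"
    by (rule free.span_minimal[OF _ f.subspace_linear_preimage[OF T]])
      (auto simp: multilinear_relators_def f.diff f.scale add scale)
  then show ?thesis using r by blast
qed

lemma relations_subset_carr: "relations scale n \<subseteq> carr (free_tensor_module \<rho> n)"
proof -
  have C: "free.subspace (carr (free_tensor_module \<rho> m))" for m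
  proof -
    interpret F: embedded_ks_module free_smul "free_tensor_module \<rho> m" id
      by (rule embedded_free_tensor_module)
    show ?thesis using F.subspace_image_submodule[OF F.submodule_carr] by simp
  qed
  have single: "Poly_Mapping.single vs 1 \<in> carr (free_tensor_module \<rho> m)" if "length vs = m" for vs m
    using that by (simp add: free_tensor_module_def)
  show ?thesis
    by (intro free.span_minimal C)
      (auto simp: multilinear_relators_def intro!: free.subspace_diff[OF C] free.subspace_scale[OF C] single)
qed

context ks_representation
begin

text \<open>As \<open>\<rho> s\<close> is linear, applying it to every entry sends a relator to a
  relator of the same shape.\<close>

lemma submodule_relations: "ks_submodule (free_tensor_module \<rho> n) (relations scale n)"
proof -
  interpret \<rho>: Vector_Spaces.linear scale scale "\<rho> s" for s by (rule linear_rep)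
  have act: "mact (free_tensor_module \<rho> n) s f =
      free_ext (\<lambda>vs. Poly_Mapping.single (map (\<rho> s) vs) 1) f" for s and f :: "'v list \<Rightarrow>\<^sub>0 'k"
    by (simp add: free_tensor_module_def free_ext_def free_smul_single)
  have "mact (free_tensor_module \<rho> n) s r \<in> relations scale n" if r: "r \<in> relations scale n" for s r
    unfolding act
    by (rule linear_image_relations[OF linear_free_ext free.subspace_span _ _ r])
      (auto simp: free_ext_single \<rho>.add \<rho>.scale intro!: relations_add relations_scale)
  then show ?thesis
    using relations_subset_carr[where n = n and scale = scale and \<rho> = \<rho>]
    by (auto simp: ks_submodule_def free_tensor_module_def free.span_zero free.span_add free.span_scale)
qed

end

section \<open>Product bases and coordinates on tensor powers\<close>

locale tensor_bases = vector_space scale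
  for scale :: "'k::field \<Rightarrow> 'v::ab_group_add \<Rightarrow> 'v" +
  fixes n :: nat and Bs :: "nat \<Rightarrow> 'v set"
  assumes indep: "independent (Bs j)"
    and span_Bs: "span (Bs j) = UNIV"
    and finite_Bs: "finite (Bs j)"
begin

text \<open>These lists index the product basis. Each position has its own basis, since the theorem
  needs a different prescribed vector at different positions.\<close>

definition words :: "'v list set" where
  "words = {ws. length ws = n \<and> (\<forall>j<n. ws ! j \<in> Bs j)}"

lemma finite_words: "finite words"
proof (rule finite_subset)
  show "words \<subseteq> {ws. set ws \<subseteq> (\<Union>j<n. Bs j) \<and> length ws = n}"
    by (force simp: words_def in_set_conv_nth)
  show "finite {ws. set ws \<subseteq> (\<Union>j<n. Bs j) \<and> length ws = n}"
    by (intro finite_lists_length_eq) (auto simp: finite_Bs)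
qed

text \<open>The coefficient of the product basis tensor of \<open>ws\<close> in the expansion of the
  pure tensor of \<open>vs\<close>.\<close>

definition word_coeff :: "'v list \<Rightarrow> 'v list \<Rightarrow> 'k" where
  "word_coeff vs ws = (\<Prod>j<n. representation (Bs j) (vs ! j) (ws ! j))"

text \<open>
  The linear projection of the free module onto the span of the words: on combinations of lists
  of length \<open>n\<close> its kernel is spanned by the multilinearity relations, so it embeds the tensor power.
\<close>

definition expand :: "('v list \<Rightarrow>\<^sub>0 'k) \<Rightarrow> 'v list \<Rightarrow>\<^sub>0 'k" where
  "expand = free_ext (\<lambda>vs. \<Sum>ws\<in>words. Poly_Mapping.single ws (word_coeff vs ws))"

sublocale expand: Vector_Spaces.linear free_smul free_smul expand
  unfolding expand_def by (rule linear_free_ext)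

lemma expand_single:
  "expand (Poly_Mapping.single vs 1) = (\<Sum>ws\<in>words. Poly_Mapping.single ws (word_coeff vs ws))"
  by (simp add: expand_def free_ext_single)

lemma lookup_expand_single:
  "Poly_Mapping.lookup (expand (Poly_Mapping.single vs 1)) ws = (if ws \<in> words then word_coeff vs ws else 0)"
  by (simp add: expand_single lookup_sum lookup_single when_def finite_words)

lemma word_coeff_word:
  assumes "vs \<in> words" "ws \<in> words"
  shows "word_coeff vs ws = (if ws = vs then 1 else 0)"
proof -
  have "representation (Bs j) (vs ! j) (ws ! j) = (if ws ! j = vs ! j then 1 else 0)" if "j < n" for j
    using representation_basis[OF indep[of j], of "vs ! j"] that assms by (simp add: words_def)
  then have "word_coeff vs ws = (\<Prod>j<n. if ws ! j = vs ! j then 1 else 0)"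
    by (simp add: word_coeff_def)
  also have "\<dots> = (if ws = vs then 1 else 0)"
    using assms by (auto simp: words_def list_eq_iff_nth_eq)
  finally show ?thesis .
qed

lemma expand_word: "ws \<in> words \<Longrightarrow> expand (Poly_Mapping.single ws 1) = Poly_Mapping.single ws 1"
  by (rule poly_mapping_eqI) (auto simp: lookup_expand_single word_coeff_word lookup_single when_def)

text \<open>The factor at position \<open>length xs\<close> is split off. The entry 0 in the other
  factors is a placeholder showing that they do not depend on \<open>u\<close>, so the coefficient
  is linear in \<open>u\<close>.\<close>

lemma word_coeff_update:
  assumes "length xs + 1 + length ys = n"
  shows "word_coeff (xs @ u # ys) ws = representation (Bs (length xs)) u (ws ! length xs) *
    (\<Prod>j\<in>{..<n} - {length xs}. representation (Bs j) ((xs @ 0 # ys) ! j) (ws ! j))"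
proof -
  have "(xs @ u # ys) ! j = (xs @ 0 # ys) ! j" if "j \<noteq> length xs" for j
    using that by (simp add: nth_append nth_Cons split: nat.split)
  then have "(\<Prod>j\<in>{..<n} - {length xs}. representation (Bs j) ((xs @ u # ys) ! j) (ws ! j)) =
      (\<Prod>j\<in>{..<n} - {length xs}. representation (Bs j) ((xs @ 0 # ys) ! j) (ws ! j))"
    by (intro prod.cong) auto
  moreover have "length xs \<in> {..<n}" using assms by auto
  ultimately show ?thesis unfolding word_coeff_def
    by (subst prod.remove[of _ "length xs"]) auto
qed

lemma expand_relations:
  assumes "r \<in> relations scale n"
  shows "expand r = 0"
proof -
  have "expand r \<in> {0}"
  proof (rule linear_image_relations[OF expand.linear_axioms _ _ _ assms])
    fix xs ys :: "'v list" and u v :: 'v assume len: "length xs + 1 + length ys = n"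
    show "expand (Poly_Mapping.single (xs @ (u + v) # ys) 1) - expand (Poly_Mapping.single (xs @ u # ys) 1)
        - expand (Poly_Mapping.single (xs @ v # ys) 1) \<in> {0}"
      by (auto intro!: poly_mapping_eqI
          simp: lookup_minus lookup_add lookup_expand_single word_coeff_update[OF len] representation_add[OF indep]
            span_Bs algebra_simps)
  next
    fix xs ys :: "'v list" and u :: 'v and c assume len: "length xs + 1 + length ys = n"
    show "expand (Poly_Mapping.single (xs @ scale c u # ys) 1)
        - free_smul c (expand (Poly_Mapping.single (xs @ u # ys) 1)) \<in> {0}"
      by (auto intro!: poly_mapping_eqI
          simp: lookup_minus lookup_add lookup_expand_single word_coeff_update[OF len] representation_scale[OF indep]
            span_Bs algebra_simps)
  qed simp
  then show ?thesis by simp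
qed

text \<open>Modulo the relations every element equals its expansion in words. By linearity pure
  tensors suffice, and their entries are expanded one position at a time. Together with
  \<open>expand_relations\<close> this identifies the kernel of \<open>expand\<close>.\<close>

lemma diff_expand_relations:
  assumes f: "\<forall>vs\<in>Poly_Mapping.keys f. length vs = n"
  shows "f - expand f \<in> relations scale n"
proof -
  define T where "T = {f. f - expand f \<in> relations scale n}"
  have T: "free.subspace T"
    unfolding free.subspace_def T_def
  proof (intro conjI ballI allI; simp)
    show "0 \<in> relations scale n" by (rule free.span_zero)
  next
    fix f g assume "f - expand f \<in> relations scale n" "g - expand g \<in> relations scale n"
    from free.span_add[OF this] show "f + g - expand (f + g) \<in> relations scale n"
      by (simp add: expand.add algebra_simps)
  next
    fix f c assume "f - expand f \<in> relations scale n"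
    from free.span_scale[OF this, of c] show "free_smul c f - expand (free_smul c f) \<in> relations scale n"
      by (simp add: expand.scale free.scale_right_diff_distrib)
  qed
  have rel: "r \<in> T" if "r \<in> relations scale n" for r
    using that by (simp add: T_def expand_relations)
  \<comment> \<open>Here \<open>k\<close> is the number of leading positions whose entries are
    arbitrary: at 0 the list is a word, at \<open>n\<close> there is no restriction left.\<close>
  have single: "Poly_Mapping.single vs 1 \<in> T"
    if "k \<le> n" "length vs = n" "\<And>j. \<lbrakk>k \<le> j; j < n\<rbrakk> \<Longrightarrow> vs ! j \<in> Bs j" for k vs
    using that
  proof (induction k arbitrary: vs)
    case 0
    then have "vs \<in> words" by (simp add: words_def)
    then show ?case by (simp add: T_def expand_word free.span_zero)
  next
    case (Suc k)
    define xs ys where "xs = take k vs" and "ys = drop (Suc k) vs"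
    have vs: "vs = xs @ vs ! k # ys" and len: "length xs = k" "length xs + 1 + length ys = n"
      using Suc.prems by (auto simp: xs_def ys_def id_take_nth_drop)
    \<comment> \<open>The entries \<open>u\<close> at position \<open>k\<close> that lead into
      \<open>T\<close> form a subspace. It contains \<open>Bs k\<close> by the induction hypothesis,
      hence is the whole space.\<close>
    have "span (Bs k) \<subseteq> {u. Poly_Mapping.single (xs @ u # ys) 1 \<in> T}"
    proof (rule span_minimal)
      show "Bs k \<subseteq> {u. Poly_Mapping.single (xs @ u # ys) 1 \<in> T}"
      proof
        fix u assume u: "u \<in> Bs k"
        have "Poly_Mapping.single (xs @ u # ys) 1 \<in> T"
        proof (rule Suc.IH)
          fix j assume j: "k \<le> j" "j < n"
          show "(xs @ u # ys) ! j \<in> Bs j"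
          proof (cases "j = k")
            case True
            then show ?thesis using u len by (simp add: nth_append)
          next
            case False
            then have "(xs @ u # ys) ! j = vs ! j"
              using j len by (subst vs) (simp add: nth_append nth_Cons split: nat.split)
            then show ?thesis using Suc.prems(3) j False by simp
          qed
        qed (use Suc.prems len in auto)
        then show "u \<in> {u. Poly_Mapping.single (xs @ u # ys) 1 \<in> T}" by simp
      qed
      have scaled: "Poly_Mapping.single (xs @ scale c u # ys) 1 \<in> T"
        if "Poly_Mapping.single (xs @ u # ys) 1 \<in> T" for c u
        using free.subspace_add[OF T rel[OF relations_scale[OF len(2), where c = c and u = u]]
            free.subspace_scale[OF T that, of c]]
        by (simp add: algebra_simps)
      show "subspace {u. Poly_Mapping.single (xs @ u # ys) 1 \<in> T}"
        unfolding subspace_def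
      proof (intro conjI ballI allI; simp)
        \<comment> \<open>The scaling relation with scalar 0 shows that a pure tensor with a zero
          entry is itself a relation.\<close>
        have "Poly_Mapping.single (xs @ scale 0 0 # ys) 1 - free_smul 0 (Poly_Mapping.single (xs @ 0 # ys) 1) \<in> T"
          by (rule rel[OF relations_scale[OF len(2)]])
        then show "Poly_Mapping.single (xs @ 0 # ys) 1 \<in> T" by simp
      next
        fix u v assume "Poly_Mapping.single (xs @ u # ys) 1 \<in> T" "Poly_Mapping.single (xs @ v # ys) 1 \<in> T"
        from free.subspace_add[OF T rel[OF relations_add[OF len(2), where u = u and v = v]]
            free.subspace_add[OF T this]]
        show "Poly_Mapping.single (xs @ (u + v) # ys) 1 \<in> T" by (simp add: algebra_simps)
      next
        fix c u assume "Poly_Mapping.single (xs @ u # ys) 1 \<in> T"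
        then show "Poly_Mapping.single (xs @ scale c u # ys) 1 \<in> T" by (rule scaled)
      qed
    qed
    then have "vs ! k \<in> {u. Poly_Mapping.single (xs @ u # ys) 1 \<in> T}" by (auto simp: span_Bs)
    then show ?case using vs by simp
  qed
  have "free_ext (\<lambda>vs. Poly_Mapping.single vs 1) f \<in> T"
    unfolding free_ext_def
    using f by (intro free.subspace_sum[OF T] free.subspace_scale[OF T] single[of n]) auto
  then show ?thesis by (simp add: free_ext_id T_def)
qed

lemma expand_in_span: "expand f \<in> free.span ((\<lambda>ws. Poly_Mapping.single ws 1) ` words)"
proof -
  have "Poly_Mapping.single ws c \<in> free.span ((\<lambda>ws. Poly_Mapping.single ws 1) ` words)"
    if "ws \<in> words" for ws and c :: 'k
    using free.span_scale[OF free.span_base[of "Poly_Mapping.single ws 1"], of _ c] that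
    by (simp add: free_smul_single)
  then show ?thesis
    unfolding expand_def free_ext_def
    by (intro free.span_sum free.span_scale) auto
qed

text \<open>Since \<open>expand\<close> has the relations as kernel, it induces an embedding of the
  tensor power. Here \<open>t ws\<close> is the class of the pure tensor of \<open>ws\<close>; an
  element killing one entry sends it to a tensor with a zero entry.\<close>

lemma tensor_power_embedding:
  assumes "ks_representation scale \<rho>"
  obtains h t where "embedded_ks_module free_smul (tensor_power scale \<rho> n) h"
    "h ` carr (tensor_power scale \<rho> n) \<subseteq> free.span ((\<lambda>ws. Poly_Mapping.single ws 1) ` words)"
    "\<And>ws. ws \<in> words \<Longrightarrow> t ws \<in> carr (tensor_power scale \<rho> n)"
    "\<And>ws. ws \<in> words \<Longrightarrow> h (t ws) = Poly_Mapping.single ws 1"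
    "\<And>ws s j. \<lbrakk>ws \<in> words; j < n; \<rho> s (ws ! j) = 0\<rbrakk> \<Longrightarrow>
      mact (tensor_power scale \<rho> n) s (t ws) = mzero (tensor_power scale \<rho> n)"
proof -
  interpret ks_representation scale \<rho> by (rule assms)
  interpret F: embedded_ks_module free_smul "free_tensor_module \<rho> n" id
    by (rule embedded_free_tensor_module)
  note R = submodule_relations[of n]
  have carrF: "f \<in> carr (free_tensor_module \<rho> n) \<longleftrightarrow> (\<forall>vs\<in>Poly_Mapping.keys f. length vs = n)" for f
    by (simp add: free_tensor_module_def)
  \<comment> \<open>If \<open>expand f\<close> vanishes, then \<open>f\<close> equals
    \<open>f - expand f\<close>, which is a relation.\<close>
  have "expand (id f) = 0 \<longleftrightarrow> f \<in> relations scale n" if "f \<in> carr (free_tensor_module \<rho> n)" for f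
    using diff_expand_relations[of f] that expand_relations by (auto simp: carrF)
  then obtain h where h: "embedded_ks_module free_smul (tensor_power scale \<rho> n) h"
    and h_coset: "\<And>f. f \<in> carr (free_tensor_module \<rho> n) \<Longrightarrow> h (F.coset (relations scale n) f) = expand f"
    using F.embedded_quotient[OF R expand.linear_axioms] unfolding tensor_power_def by auto
  define t where "t ws = F.coset (relations scale n) (Poly_Mapping.single ws 1)" for ws
  have single: "Poly_Mapping.single ws 1 \<in> carr (free_tensor_module \<rho> n)" if "ws \<in> words" for ws
    using that by (simp add: carrF words_def)
  show ?thesis
  proof (rule that[OF h, of t])
    show "h ` carr (tensor_power scale \<rho> n) \<subseteq> free.span ((\<lambda>ws. Poly_Mapping.single ws 1) ` words)"
      by (auto simp: tensor_power_def F.quotient_carr h_coset expand_in_span)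
    show "t ws \<in> carr (tensor_power scale \<rho> n)" if "ws \<in> words" for ws
      unfolding t_def tensor_power_def F.quotient_carr by (rule imageI[OF single[OF that]])
    show "h (t ws) = Poly_Mapping.single ws 1" if "ws \<in> words" for ws
      by (simp add: t_def h_coset single expand_word that)
    show "mact (tensor_power scale \<rho> n) s (t ws) = mzero (tensor_power scale \<rho> n)"
      if ws: "ws \<in> words" and j: "j < n" "\<rho> s (ws ! j) = 0" for ws s j
    proof -
      have len: "length ws = n" using ws by (simp add: words_def)
      define xs ys where "xs = take j (map (\<rho> s) ws)" and "ys = drop (Suc j) (map (\<rho> s) ws)"
      \<comment> \<open>The zero entry is written \<open>scale 0 0\<close> to match a scaling
        relator.\<close>
      have eq: "map (\<rho> s) ws = xs @ scale 0 0 # ys" "length xs + 1 + length ys = n"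
        using j len id_take_nth_drop[of j "map (\<rho> s) ws"] by (auto simp: xs_def ys_def)
      have "mact (free_tensor_module \<rho> n) s (Poly_Mapping.single ws 1) = Poly_Mapping.single (map (\<rho> s) ws) (1::'k)"
        by (simp add: free_tensor_module_def)
      also have "\<dots> \<in> relations scale n"
        using relations_scale[OF eq(2), where scale = scale and c = 0 and u = 0] unfolding eq(1) by simp
      finally have "F.coset (relations scale n) (mact (free_tensor_module \<rho> n) s (Poly_Mapping.single ws 1)) =
          relations scale n"
        using F.coset_eq_self_iff[OF R F.act_carr[OF single[OF ws]]] by blast
      then show ?thesis
        unfolding t_def tensor_power_def F.quotient_act[OF R single[OF ws]] F.quotient_mzero .
    qed
  qed
qed

end

subsection \<open>Counting annihilated words\<close>

lemma card_lists_nth: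
  "card {ws. length ws = n \<and> (\<forall>j<n. ws ! j \<in> A j)} = (\<Prod>j<n. card (A j))"
proof (induction n)
  case 0
  have "{ws. length ws = 0 \<and> (\<forall>j<0. ws ! j \<in> A j)} = {[]}" by auto
  then show ?case by simp
next
  case (Suc n)
  let ?X = "\<lambda>n. {ws. length ws = n \<and> (\<forall>j<n. ws ! j \<in> A j)}"
  have "?X (Suc n) = (\<lambda>(ws, a). ws @ [a]) ` (?X n \<times> A n)"
  proof (intro equalityI subsetI)
    fix ws assume ws: "ws \<in> ?X (Suc n)"
    then have "ws \<noteq> []" by auto
    with ws have "ws = butlast ws @ [ws ! n]" using last_conv_nth[of ws] append_butlast_last_id[of ws] by simp
    moreover have "butlast ws \<in> ?X n" using ws by (auto simp: nth_butlast)
    moreover have "ws ! n \<in> A n" using ws by auto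
    ultimately show "ws \<in> (\<lambda>(ws, a). ws @ [a]) ` (?X n \<times> A n)"
      by (intro image_eqI[of _ _ "(butlast ws, ws ! n)"]) auto
  qed (auto simp: nth_append less_Suc_eq)
  moreover have "inj_on (\<lambda>(ws, a). ws @ [a]) (?X n \<times> A n)" by (auto simp: inj_on_def)
  ultimately show ?case
    by (simp add: card_image card_cartesian_product Suc.IH mult.commute)
qed

context tensor_bases
begin

text \<open>The tensors of words in \<open>G\<close> are independent and annihilated, which bounds
  the length from below and yields a null factor. The tensors of all words span, which bounds it
  from above.\<close>

lemma tensor_power_composition:
  assumes rep: "ks_representation scale \<rho>"
    and G: "G \<subseteq> words" "\<And>ws s. ws \<in> G \<Longrightarrow> \<exists>j<n. \<rho> s (ws ! j) = 0"
  shows "card G \<le> composition_length (tensor_power scale \<rho> n)"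
    and "composition_length (tensor_power scale \<rho> n) \<le> card words"
    and "G \<noteq> {} \<Longrightarrow> composition_factor null_module (tensor_power scale \<rho> n)"
proof -
  let ?T = "tensor_power scale \<rho> n" and ?E = "(\<lambda>ws. Poly_Mapping.single ws (1::'k)) ` words"
  obtain h t where h: "embedded_ks_module free_smul ?T h" "h ` carr ?T \<subseteq> free.span ?E"
    and t: "\<And>ws. ws \<in> words \<Longrightarrow> t ws \<in> carr ?T" "\<And>ws. ws \<in> words \<Longrightarrow> h (t ws) = Poly_Mapping.single ws 1"
    and act: "\<And>ws s j. \<lbrakk>ws \<in> words; j < n; \<rho> s (ws ! j) = 0\<rbrakk> \<Longrightarrow> mact ?T s (t ws) = mzero ?T"
    using tensor_power_embedding[OF rep] by metis
  interpret T: embedded_ks_module free_smul ?T h by (rule h)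
  have single_inj: "inj_on (\<lambda>ws. Poly_Mapping.single ws (1::'k)) A" for A :: "'v list set"
    by (auto simp: inj_on_def dest!: arg_cong[of _ _ Poly_Mapping.keys])
  have E: "finite ?E" "card ?E = card words"
    by (simp_all add: finite_words card_image[OF single_inj])
  have kill: "mact ?T s (t ws) = mzero ?T" if "ws \<in> G" for ws s
    using G that act by blast
  have ht: "h (t ws) = Poly_Mapping.single ws 1" if "ws \<in> G" for ws using t G that by blast
  have inj_ht: "inj_on (h \<circ> t) G" using single_inj[of G] ht by (simp add: inj_on_def)
  have "\<exists>Ns. composition_series ?T Ns"
    using T.composition_series_through[OF T.submodule_zero E(1) h(2)] by blast
  then have "\<exists>l Ns. composition_series ?T Ns \<and> length Ns = Suc l"
    by (metis composition_series_def length_Suc_conv_rev rev_exhaust length_append_singleton)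
  \<comment> \<open>Existence of a series ensures that the number chosen in
    \<open>composition_length\<close> is attained; both bounds are then applied to this
    series.\<close>
  then obtain Ns where Ns: "composition_series ?T Ns" "length Ns = Suc (composition_length ?T)"
    unfolding composition_length_def by (rule someI_ex[THEN exE]) blast
  show "composition_length ?T \<le> card words"
    using T.composition_series_length_le[OF Ns(1) E(1) h(2)] Ns(2) E(2) by simp
  have "h ` t ` G = (\<lambda>ws. Poly_Mapping.single ws 1) ` G"
    unfolding image_image using ht by (rule image_cong[OF refl])
  then have "card (t ` G) < length Ns"
    using t(1) G(1) kill
    by (intro T.composition_series_length_ge[OF Ns(1)])
      (auto simp: independent_single intro: inj_on_imageI[OF inj_ht])
  then show "card G \<le> composition_length ?T"
    using Ns(2) card_image[OF inj_on_imageI2[OF inj_ht]] by simp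
  show "composition_factor null_module ?T" if "G \<noteq> {}"
  proof -
    obtain ws where ws: "ws \<in> G" using \<open>G \<noteq> {}\<close> by blast
    have "h (t ws) \<noteq> h (mzero ?T)" using ht[OF ws] by (metis T.h_zero lookup_single_eq lookup_zero zero_neq_one)
    then have "t ws \<noteq> mzero ?T" by metis
    then show ?thesis
      using T.null_composition_factor[of "t ws"] ws G(1) t(1) kill E(1) h(2) by blast
  qed
qed

end

lemma filterlim_div_nat_at_top:
  assumes "(L::nat) > 0"
  shows "filterlim (\<lambda>n. n div L) at_top at_top"
  unfolding filterlim_at_top
proof
  fix Z
  show "eventually (\<lambda>n. Z \<le> n div L) at_top"
    using eventually_ge_at_top[of "Z * L"]
    by eventually_elim (use assms div_le_mono[of "Z * L" _ L] in auto)
qed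

text \<open>The numbers \<open>q * L + i\<close> with \<open>q < n div L\<close> are distinct and
  lie below \<open>n\<close>, because \<open>i < L\<close>.\<close>

lemma card_residue_class_ge:
  assumes "i < (L::nat)"
  shows "n div L \<le> card {j \<in> {..<n}. j mod L = i}"
proof -
  have "(\<lambda>q. q * L + i) ` {..<n div L} \<subseteq> {j \<in> {..<n}. j mod L = i}"
  proof
    fix j assume "j \<in> (\<lambda>q. q * L + i) ` {..<n div L}"
    then obtain q where q: "q < n div L" "j = q * L + i" by auto
    then have "Suc q * L \<le> n div L * L" by (intro mult_right_mono) auto
    also have "\<dots> \<le> n" by simp
    finally show "j \<in> {j \<in> {..<n}. j mod L = i}" using q assms by auto
  qed
  moreover have "inj_on (\<lambda>q. q * L + i) {..<n div L}" using assms by (auto simp: inj_on_def)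
  ultimately show ?thesis
    using card_mono[of "{j \<in> {..<n}. j mod L = i}" "(\<lambda>q. q * L + i) ` {..<n div L}"]
    by (simp add: card_image)
qed

text \<open>In finite dimension a noninvertible \<open>\<rho> x\<close> has a nonzero kernel vector.
  An element \<L>-equivalent to \<open>x\<close> is \<open>x\<close> or a left multiple of it, so it
  kills the same vector.\<close>

lemma common_kernel_vector:
  fixes \<rho> :: "'s::semigroup_mult \<Rightarrow> 'v::ab_group_add \<Rightarrow> 'v"
  assumes rep: "ks_representation scale \<rho>"
    and findim: "finite_dimensional_vector_space scale Basis"
    and noninvertible: "\<And>s. \<not> bij (\<rho> s)"
    and q: "q \<in> UNIV // L_equiv"
  shows "\<exists>v. v \<noteq> 0 \<and> (\<forall>s\<in>q. \<rho> s v = 0)"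
proof -
  interpret ks_representation scale \<rho> by (rule rep)
  interpret finite_dimensional_vector_space scale Basis by (rule findim)
  interpret \<rho>: Vector_Spaces.linear scale scale "\<rho> s" for s by (rule linear_rep)
  obtain x where x: "q = L_equiv `` {x}" using q by (auto elim: quotientE)
  have "\<not> inj (\<rho> x)"
    using linear_inj_imp_surj[OF linear_rep] noninvertible[of x] by (auto simp: bij_def)
  then obtain v where v: "v \<noteq> 0" "\<rho> x v = 0" by (auto simp: \<rho>.inj_iff_eq_0)
  have "\<rho> s v = 0" if "s \<in> q" for s
  proof -
    have "s \<in> left_ideal1 x" using that by (auto simp: x L_equiv_def left_ideal1_def)
    then show ?thesis using v by (auto simp: left_ideal1_def rep_mult \<rho>.zero)
  qed
  then show ?thesis using v by blast
qed

theorem proposition4p0p1: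
  fixes scale :: "'k::alg_closed_field \<Rightarrow> 'v::ab_group_add \<Rightarrow> 'v"
    and Basis :: "'v set"
    and \<rho> :: "'s::{semigroup_mult, finite} \<Rightarrow> 'v \<Rightarrow> 'v"
  assumes no_identity: "\<not> (\<exists>e::'s. \<forall>x. e * x = x \<and> x * e = x)"
    and rep: "ks_representation scale \<rho>"
    and findim: "finite_dimensional_vector_space scale Basis"
    and nonzero: "\<exists>v::'v. v \<noteq> 0"
    and noninvertible: "\<And>s. \<not> bij (\<rho> s)"
  shows "(\<lambda>n. real (composition_length (tensor_power scale \<rho> n)))
           \<sim>[at_top] (\<lambda>n. real (vector_space.dim scale (UNIV :: 'v set)) ^ n)
       \<and> (\<exists>n. composition_factor null_module (tensor_power scale \<rho> n))
       \<and> (LEAST n. composition_factor null_module (tensor_power scale \<rho> n))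
           \<le> card ((UNIV :: 's set) // L_equiv)"
proof -
  interpret finite_dimensional_vector_space scale Basis by (rule findim)
  define d where "d = dim (UNIV :: 'v set)"
  let ?Q = "(UNIV :: 's set) // L_equiv"
  define L where "L = card ?Q"
  have finQ: "finite ?Q" by simp
  have "?Q \<noteq> {}" by (simp add: quotient_def)
  then have L: "L > 0" using finQ by (simp add: L_def card_gt_0_iff)
  \<comment> \<open>The \<L>-classes are numbered from 0 so that residues modulo \<open>L\<close>
    can index them.\<close>
  obtain e where e: "bij_betw e {0..<L} ?Q" using ex_bij_betw_nat_finite[OF finQ] by (auto simp: L_def)
  obtain vq where vq: "\<And>q. q \<in> ?Q \<Longrightarrow> vq q \<noteq> 0" "\<And>q s. \<lbrakk>q \<in> ?Q; s \<in> q\<rbrakk> \<Longrightarrow> \<rho> s (vq q) = 0"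
    using common_kernel_vector[OF rep findim noninvertible] by metis
  define v where "v i = vq (e i)" for i
  have v_nonzero: "v i \<noteq> 0" if "i < L" for i
    using vq(1) bij_betwE[OF e] that by (auto simp: v_def)
  have kill: "\<exists>i<L. \<rho> s (v i) = 0" for s
  proof -
    have "L_equiv `` {s} \<in> ?Q" by (rule quotientI) simp
    moreover have "s \<in> L_equiv `` {s}" by (simp add: L_equiv_def)
    ultimately show ?thesis using vq(2) e unfolding v_def bij_betw_def
      by (metis atLeastLessThan_iff imageE)
  qed
  have "\<exists>B. independent B \<and> span B = UNIV \<and> u \<in> B" if "u \<noteq> 0" for u :: 'v
    using that independent_extend_basis[of "{u}"] extend_basis_superset[of "{u}"] span_extend_basis[of "{u}"]
    by (intro exI[of _ "extend_basis {u}"]) auto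
  then obtain Bf where Bf: "\<And>u :: 'v. u \<noteq> 0 \<Longrightarrow> independent (Bf u) \<and> span (Bf u) = UNIV \<and> u \<in> Bf u"
    by metis
  define Bs where "Bs j = Bf (v (j mod L))" for j
  have Bs: "independent (Bs j)" "span (Bs j) = UNIV" "v (j mod L) \<in> Bs j" "finite (Bs j)" "card (Bs j) = d" for j
    using Bf[OF v_nonzero[of "j mod L"]] L finiteI_independent dim_eq_card[of "Bs j" UNIV]
    by (auto simp: Bs_def d_def)
  have d: "d > 0" using Bs(3,4,5)[of 0] card_gt_0_iff by blast
  interpret tensor_bases scale n Bs for n
    by unfold_locales (use Bs in auto)
  \<comment> \<open>Each \<open>s\<close> kills some \<open>v i\<close>, hence an entry of every
    word in which each \<open>v i\<close> occurs at a position of residue \<open>i\<close>.\<close>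
  define G where "G n = {ws \<in> words n. \<forall>i<L. \<exists>j<n. j mod L = i \<and> ws ! j = v i}" for n
  have G: "G n \<subseteq> words n" "\<And>ws s. ws \<in> G n \<Longrightarrow> \<exists>j<n. \<rho> s (ws ! j) = 0" for n
    using kill by (auto simp: G_def) metis
  note comp = tensor_power_composition[OF rep G]
  have card_words: "card (words n) = d ^ n" for n
    by (simp add: words_def card_lists_nth Bs)
  \<comment> \<open>The share 1 - 1/d of basis vectors that remain at a position after one is
    excluded.\<close>
  define r where "r = real (d - 1) / real d"
  have r: "0 \<le> r" "r < 1" using d by (auto simp: r_def)
  have bad: "real (card (words n - G n)) \<le> real d ^ n * (real L * r ^ (n div L))" for n
  proof -
    \<comment> \<open>The words that avoid \<open>v i\<close> at all positions of residue
      \<open>i\<close>. A word outside \<open>G n\<close> lies in one of these \<open>L\<close>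
      sets, so a union bound applies.\<close>
    define W where "W i = {ws. length ws = n \<and> (\<forall>j<n. ws ! j \<in> (if j mod L = i then Bs j - {v i} else Bs j))}" for i
    have W: "real (card (W i)) \<le> real d ^ n * r ^ (n div L)" if i: "i < L" for i
    proof -
      have "card (W i) = (\<Prod>j<n. if j mod L = i then d - 1 else d)"
        unfolding W_def card_lists_nth using Bs by (intro prod.cong) (auto simp: card_Diff_singleton)
      then have "real (card (W i)) = (\<Prod>j<n. real d * (if j mod L = i then r else 1))"
        using d by (auto simp: r_def intro!: prod.cong)
      also have "\<dots> = real d ^ n * r ^ card {j \<in> {..<n}. j mod L = i}"
        by (simp add: prod.distrib prod.If_cases Int_def)
      \<comment> \<open>As \<open>r\<close> lies between 0 and 1, lowering the exponent to the
        guaranteed number of positions can only increase the power.\<close>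
      also have "\<dots> \<le> real d ^ n * r ^ (n div L)"
        using r card_residue_class_ge[OF i] by (intro mult_left_mono power_decreasing) auto
      finally show ?thesis .
    qed
    have "words n - G n \<subseteq> (\<Union>i<L. W i)"
      by (auto simp: G_def W_def words_def)
    moreover have "W i \<subseteq> words n" for i by (auto simp: W_def words_def split: if_splits)
    then have finW: "finite (W i)" for i using finite_words finite_subset by blast
    ultimately have "card (words n - G n) \<le> card (\<Union>i<L. W i)" by (intro card_mono) auto
    also have "\<dots> \<le> (\<Sum>i<L. card (W i))" by (rule card_UN_le) simp
    finally have "real (card (words n - G n)) \<le> (\<Sum>i<L. real (card (W i)))" by (simp flip: of_nat_sum)
    also have "\<dots> \<le> (\<Sum>i<L. real d ^ n * r ^ (n div L))" using W by (intro sum_mono) auto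
    finally show ?thesis by (simp add: mult_ac)
  qed
  have lower: "1 - real L * r ^ (n div L) \<le> real (composition_length (tensor_power scale \<rho> n)) / real d ^ n" for n
  proof -
    have "card (words n) = card (G n) + card (words n - G n)"
      using G(1)[of n] finite_words card_Diff_subset[of "G n" "words n"] card_mono[of "words n" "G n"]
      by (simp add: finite_subset)
    then have "real d ^ n \<le> real (composition_length (tensor_power scale \<rho> n)) + real d ^ n * (real L * r ^ (n div L))"
      using bad[of n] comp(1)[of n] card_words[of n] by (simp flip: of_nat_power)
    then show ?thesis using d by (simp add: field_simps)
  qed
  have upper: "real (composition_length (tensor_power scale \<rho> n)) / real d ^ n \<le> 1" for n
    using comp(2)[of n] d by (simp add: card_words flip: of_nat_power)
  have "(\<lambda>n. r ^ (n div L)) \<longlonglongrightarrow> 0"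
    using LIMSEQ_power_zero[of r] r filterlim_compose[OF _ filterlim_div_nat_at_top[OF L], of "\<lambda>n. r ^ n"]
    by auto
  then have lim: "(\<lambda>n. 1 - real L * r ^ (n div L)) \<longlonglongrightarrow> 1 - real L * 0"
    by (intro tendsto_intros)
  have "(\<lambda>n. real (composition_length (tensor_power scale \<rho> n)) / real d ^ n) \<longlonglongrightarrow> 1"
  proof (rule tendsto_sandwich)
    show "(\<lambda>n. 1 - real L * r ^ (n div L)) \<longlonglongrightarrow> 1" using lim by simp
    show "eventually (\<lambda>n. real (composition_length (tensor_power scale \<rho> n)) / real d ^ n \<le> 1) at_top"
      using upper by (simp add: always_eventually)
  qed (use lower in \<open>simp_all add: always_eventually\<close>)
  then have "(\<lambda>n. real (composition_length (tensor_power scale \<rho> n))) \<sim>[at_top] (\<lambda>n. real d ^ n)"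
    by (rule asymp_equivI')
  moreover have factor: "composition_factor null_module (tensor_power scale \<rho> L)"
  proof (rule comp(3))
    have "v j \<in> Bs j" if "j < L" for j using Bs(3)[of j] that by simp
    \<comment> \<open>For \<open>n = L\<close> position \<open>j\<close> has residue
      \<open>j\<close>, so this single word meets every condition.\<close>
    then have "map v [0..<L] \<in> G L" by (auto simp: G_def words_def)
    then show "G L \<noteq> {}" by blast
  qed
  moreover have "(LEAST n. composition_factor null_module (tensor_power scale \<rho> n)) \<le> L"
    using factor by (rule Least_le)
  ultimately show ?thesis
    unfolding d_def L_def by blast
qed

end
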